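(* For each fixed $\varepsilon>0$ there exists a constant $C=C_\varepsilon$ such that the following holds. Let $r=r(n)$ and $p=p(n)$ satisfy $nr^2 \ge \log n$ and $C/(nr^2) \le 1-p \le (\log n)^{-3}$. Then, with probability tending to $1$ as $n\to\infty$, the graph $G=G(n,r,p)$ satisfies \[ \frac{(2-\varepsilon)\log\left[(1-p)nr^2\right]}{1-p} \le \omega(G) \le \frac{2\log\left[(1-p)nr^2\right]}{1-p}, \] where $\omega(G)$ is the clique number of $G$.
   Context: The random graph $G(n,r,p)$ is defined as follows. Place $n$ points independently and uniformly at random in the unit torus $[0,1]^2$ (opposite sides identified), and join two points by an edge if their distance in the torus metric is at most $r$; this is the random geometric graph $G(n,r)$. Independently, let $G(n,p)$ be the Erdős–Rényi random graph on the same $n$ vertices, where each pair is an edge independently with probability $p$. Then $G(n,r,p)=G(n,r)\cap G(n,p)$, i.e. each edge of $G(n,r)$ is kept independently with probability $p$. Logarithms are natural.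
   Formalization: The distance r is required to satisfy 0 ≤ r ≤ √2/2, the diameter of the unit torus; for unbounded r the claim fails (e.g. r = n, 1-p = (log n)^{-3}, where G is just G(n,p) and the lower bound is about three times too large). *)

theory Defs
  imports "HOL-Probability.Probability" "HOL-Library.Ramsey"
begin

definition clique_number :: "'a set \<Rightarrow> 'a set set \<Rightarrow> nat" where
  "clique_number V E = Max {card S | S. S \<subseteq> V \<and> clique S E}"

text \<open>The distance of two points of \<open>[0,1]\<close> in the circle \<open>\<real>/\<int>\<close>, and the resulting
  Euclidean distance of two points of \<open>[0,1]\<^sup>2\<close> in the unit torus \<open>\<real>\<^sup>2/\<int>\<^sup>2\<close>. The
  formulas are meaningful only for coordinates in \<open>[0,1]\<close>.\<close>

definition circle_dist :: "real \<Rightarrow> real \<Rightarrow> real" where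
  "circle_dist x y = min \<bar>x - y\<bar> (1 - \<bar>x - y\<bar>)"

definition torus_dist :: "real \<times> real \<Rightarrow> real \<times> real \<Rightarrow> real" where
  "torus_dist x y =
     sqrt ((circle_dist (fst x) (fst y))\<^sup>2 + (circle_dist (snd x) (snd y))\<^sup>2)"

text \<open>The vertex set is \<open>{..<n}\<close>, with vertex \<open>i\<close> placed at \<open>X i\<close>. The value \<open>B e\<close> of the
  coin attached to the pair \<open>e\<close> decides whether \<open>e\<close> is an edge of the Erdos--Renyi graph.\<close>

definition geometric_edges :: "nat \<Rightarrow> real \<Rightarrow> (nat \<Rightarrow> real \<times> real) \<Rightarrow> nat set set" where
  "geometric_edges n r X =
     {{i, j} | i j. i < n \<and> j < n \<and> i \<noteq> j \<and> torus_dist (X i) (X j) \<le> r}"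

definition binomial_edges :: "nat \<Rightarrow> (nat set \<Rightarrow> bool) \<Rightarrow> nat set set" where
  "binomial_edges n B = {e \<in> nsets {..<n} 2. B e}"

definition Gnrp_edges ::
    "nat \<Rightarrow> real \<Rightarrow> (nat \<Rightarrow> real \<times> real) \<times> (nat set \<Rightarrow> bool) \<Rightarrow> nat set set" where
  "Gnrp_edges n r \<omega> = geometric_edges n r (fst \<omega>) \<inter> binomial_edges n (snd \<omega>)"

definition Gnrp_space ::
    "nat \<Rightarrow> real \<Rightarrow> ((nat \<Rightarrow> real \<times> real) \<times> (nat set \<Rightarrow> bool)) measure" where
  "Gnrp_space n p =
     (\<Pi>\<^sub>M i\<in>{..<n}. uniform_measure lborel ({0..1} \<times> {0..1}))
     \<Otimes>\<^sub>M (\<Pi>\<^sub>M e\<in>nsets {..<n} 2. measure_pmf (bernoulli_pmf p))"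

lemma prob_space_Gnrp_space: "prob_space (Gnrp_space n p)"
proof -
  have "emeasure lborel ({0..1::real} \<times> {0..1::real}) = 1"
    by (simp add: lborel_prod[symmetric] lborel.emeasure_pair_measure_Times)
  then have U: "prob_space (uniform_measure lborel ({0..1::real} \<times> {0..1::real}))"
    by (intro prob_space_uniform_measure) auto
  have "prob_space (\<Pi>\<^sub>M i\<in>{..<n}. uniform_measure lborel ({0..1::real} \<times> {0..1::real}))"
    by (intro prob_space_PiM U)
  moreover have "prob_space (\<Pi>\<^sub>M e\<in>nsets {..<n} 2. measure_pmf (bernoulli_pmf p))"
    by (intro prob_space_PiM measure_pmf.prob_space_axioms)
  ultimately show ?thesis
    unfolding Gnrp_space_def by (intro prob_space_pair)
qed

end

theory Submission
  imports Defs "HOL-Real_Asymp.Real_Asymp"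
begin

text \<open>
  Write \<open>q = 1 - p\<close>, \<open>N = n r\<^sup>2\<close> and \<open>L = ln (q N)\<close>. The upper bound is a first moment computation:
  the points of a clique all lie in the \<open>r\<close>-ball around one of them, an event of probability
  \<open>O(r\<^sup>2)\<close> per point.

  For the lower bound, a cell of side \<open>r / 2\<close> contains at least \<open>N / 16\<close> points, all within
  distance \<open>r\<close> of each other. Split them into \<open>k = (2 - \<epsilon> / 2) L / q\<close> blocks of size
  \<open>s = N / (16 k)\<close> and look for a clique with one vertex in each block. This costs only a
  factor \<open>e\<^sup>k\<close> in the expected number of cliques, and makes the overlap of two random choices
  \<open>Bin(k, 1 / s)\<close>, so that the second moment method gives a full transversal clique with
  probability at least \<open>exp (- o(k))\<close>. The size of the largest partial transversal clique changes by at
  most 1 when the coins of one block are changed; there are only \<open>k\<close> blocks, so bounded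
  differences show that a lower deviation of order \<open>k\<close> has probability \<open>exp (- \<Omega>(k))\<close>
  times \<open>exp (o(k))\<close>.
\<close>

subsection \<open>Bounded differences\<close>

lemma expectation_pair_pmf_finite:
  fixes f :: "'a \<times> 'b \<Rightarrow> real"
  assumes "finite (set_pmf A)" "finite (set_pmf B)"
  shows "measure_pmf.expectation (pair_pmf A B) f =
    measure_pmf.expectation A (\<lambda>a. measure_pmf.expectation B (\<lambda>b. f (a, b)))"
proof -
  have "measure_pmf.expectation (pair_pmf A B) f =
      (\<Sum>x\<in>set_pmf A \<times> set_pmf B. pmf (pair_pmf A B) x *\<^sub>R f x)"
    using assms by (intro integral_measure_pmf) auto
  also have "\<dots> = (\<Sum>a\<in>set_pmf A. pmf A a *\<^sub>R (\<Sum>b\<in>set_pmf B. pmf B b *\<^sub>R f (a, b)))"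
    by (subst sum.cartesian_product') (simp add: pmf_pair sum_distrib_left mult_ac)
  also have "\<dots> = measure_pmf.expectation A (\<lambda>a. measure_pmf.expectation B (\<lambda>b. f (a, b)))"
    using assms by (simp add: integral_measure_pmf[of "set_pmf B"] integral_measure_pmf[of "set_pmf A"])
  finally show ?thesis .
qed

text \<open>Oscillation at most 1 places the values of \<open>f\<close> on the support in
  \<open>[a, a + 1]\<close>, with \<open>a\<close> the minimum there, so Hoeffding's lemma applies.
  Finite support turns its nonnegative integral into an expectation.\<close>

lemma Hoeffdings_lemma_pmf:
  fixes f :: "'a \<Rightarrow> real"
  assumes fin: "finite (set_pmf M)" and f: "\<And>x y. \<bar>f x - f y\<bar> \<le> 1" and l: "l > 0"
  shows "measure_pmf.expectation M (\<lambda>x. exp (l * (f x - measure_pmf.expectation M f))) \<le> exp (l\<^sup>2 / 8)"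
proof -
  define a where "a = Min (f ` set_pmf M)"
  have ne: "f ` set_pmf M \<noteq> {}" "finite (f ` set_pmf M)"
    using fin set_pmf_not_empty[of M] by auto
  obtain x0 where x0: "a = f x0"
    using Min_in[OF ne(2,1)] unfolding a_def by blast
  have fa: "f x \<in> {a..a+1}" if "x \<in> set_pmf M" for x
    using f[of x x0] Min_le[OF ne(2)] that unfolding x0[symmetric] a_def by auto
  interpret interval_bounded_random_variable "measure_pmf M" f a "a + 1"
    by unfold_locales (use fa in \<open>auto simp: AE_measure_pmf_iff\<close>)
  have "ennreal (measure_pmf.expectation M (\<lambda>x. exp (l * (f x - measure_pmf.expectation M f))))
     = (\<integral>\<^sup>+x. exp (l * (f x - measure_pmf.expectation M f)) \<partial>M)"
    by (intro nn_integral_eq_integral[symmetric] integrable_measure_pmf_finite fin) auto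
  also have "\<dots> \<le> ennreal (exp (l\<^sup>2 * (a + 1 - a)\<^sup>2 / 8))"
    by (rule Hoeffdings_lemma_nn_integral[OF l])
  finally show ?thesis by simp
qed

lemma expectation_mono_finite:
  fixes f g :: "'a \<Rightarrow> real"
  assumes "finite (set_pmf M)" "\<And>x. x \<in> set_pmf M \<Longrightarrow> f x \<le> g x"
  shows "measure_pmf.expectation M f \<le> measure_pmf.expectation M g"
  using assms by (intro integral_mono_AE integrable_measure_pmf_finite) (auto simp: AE_measure_pmf_iff)

lemma finite_set_Pi_pmf:
  assumes "finite E" "\<And>e. finite (set_pmf (p e))"
  shows "finite (set_pmf (Pi_pmf E d p))"
  using assms by (subst set_Pi_pmf) auto

text \<open>McDiarmid's inequality for coins grouped into \<open>k\<close> blocks by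
  \<open>c\<close>, by induction on \<open>k\<close>. Given the first blocks, \<open>f\<close>
  varies by at most 1 in the last one, so Hoeffding's lemma contributes a factor
  \<open>exp (l^2 / 8)\<close>. The conditional mean \<open>g\<close> inherits the block Lipschitz
  property and is handled by the induction hypothesis.\<close>

lemma bounded_differences_mgf:
  fixes f :: "('a \<Rightarrow> 'b) \<Rightarrow> real" and c :: "'a \<Rightarrow> nat"
  assumes "finite E" "\<And>e. finite (set_pmf (p e))" "c ` E \<subseteq> {..<k}" "l > 0"
    and "\<And>j x y. (\<And>e. e \<notin> E \<or> c e \<noteq> j \<Longrightarrow> x e = y e) \<Longrightarrow> \<bar>f x - f y\<bar> \<le> 1"
  shows "measure_pmf.expectation (Pi_pmf E d p)
           (\<lambda>x. exp (l * (f x - measure_pmf.expectation (Pi_pmf E d p) f))) \<le> exp (l\<^sup>2 * real k / 8)"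
  using assms
proof (induction k arbitrary: E f)
  case 0
  then have "E = {}" by auto
  then show ?case by simp
next
  case (Suc k)
  note p [simp] = Suc.prems(2)
  define A where "A = {e\<in>E. c e < k}"
  define B where "B = {e\<in>E. c e = k}"
  have [simp]: "finite A" "finite B" using Suc.prems by (auto simp: A_def B_def)
  have E: "E = A \<union> B" and AB: "A \<inter> B = {}" using Suc.prems(3) by (auto simp: A_def B_def)
  define PA where "PA = Pi_pmf A d p"
  define PB where "PB = Pi_pmf B d p"
  have [simp]: "finite (set_pmf PA)" "finite (set_pmf PB)"
    unfolding PA_def PB_def by (intro finite_set_Pi_pmf; simp)+
  \<comment> \<open>\<open>h\<close> glues the coins of the first \<open>k\<close> blocks to those
    of the last one; \<open>g\<close> below is the expectation of \<open>f\<close> given the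
    former.\<close>
  define h :: "('a \<Rightarrow> 'b) \<Rightarrow> ('a \<Rightarrow> 'b) \<Rightarrow> ('a \<Rightarrow> 'b)"
    where "h = (\<lambda>x y e. if e \<in> A then x e else y e)"
  define g where "g = (\<lambda>x. measure_pmf.expectation PB (\<lambda>y. f (h x y)))"
  have split: "measure_pmf.expectation (Pi_pmf E d p) \<phi> =
      measure_pmf.expectation PA (\<lambda>x. measure_pmf.expectation PB (\<lambda>y. \<phi> (h x y)))"
    for \<phi> :: "('a \<Rightarrow> 'b) \<Rightarrow> real"
    unfolding E by (subst Pi_pmf_union[OF _ _ AB])
      (auto simp: expectation_pair_pmf_finite PA_def[symmetric] PB_def[symmetric] h_def)
  have Ef: "measure_pmf.expectation (Pi_pmf E d p) f = measure_pmf.expectation PA g"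
    by (simp add: split g_def)
  define \<mu> where "\<mu> = measure_pmf.expectation PA g"
  have glip: "\<bar>g x - g y\<bar> \<le> 1" if "\<And>e. e \<notin> A \<or> c e \<noteq> j \<Longrightarrow> x e = y e" for j x y
  proof -
    have *: "\<bar>f (h x z) - f (h y z)\<bar> \<le> 1" for z
      by (rule Suc.prems(5)[of j]) (use that in \<open>auto simp: h_def A_def\<close>)
    have "g x - g y = measure_pmf.expectation PB (\<lambda>z. f (h x z) - f (h y z))"
      unfolding g_def by (intro Bochner_Integration.integral_diff[symmetric] integrable_measure_pmf_finite) auto
    also have "\<bar>\<dots>\<bar> \<le> measure_pmf.expectation PB (\<lambda>z. \<bar>f (h x z) - f (h y z)\<bar>)"
      by (rule integral_abs_bound)
    also have "\<dots> \<le> measure_pmf.expectation PB (\<lambda>_. 1)"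
      by (intro expectation_mono_finite) (use * in auto)
    finally show ?thesis by simp
  qed
  have IH: "measure_pmf.expectation PA (\<lambda>x. exp (l * (g x - \<mu>))) \<le> exp (l\<^sup>2 * real k / 8)"
    unfolding PA_def \<mu>_def
  proof (rule Suc.IH)
    show "c ` A \<subseteq> {..<k}" by (auto simp: A_def)
    show "\<bar>g x - g y\<bar> \<le> 1" if "\<And>e. e \<notin> A \<or> c e \<noteq> j \<Longrightarrow> x e = y e" for j x y
      using glip[OF that] .
  qed (use Suc.prems(4) in auto)
  have inner: "measure_pmf.expectation PB (\<lambda>y. exp (l * (f (h x y) - \<mu>))) \<le>
      exp (l * (g x - \<mu>)) * exp (l\<^sup>2 / 8)" for x
  proof -
    \<comment> \<open>The oscillation bound compares only arguments that agree outside
      \<open>E\<close>, whereas \<open>Hoeffdings_lemma_pmf\<close> quantifies over all arguments.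
      \<open>R\<close> resets everything outside the last block to \<open>d\<close>, which changes
      nothing on the support of \<open>PB\<close>.\<close>
    define R where "R = (\<lambda>y e. if e \<in> B then y e else d)"
    have R: "R y = y" if "y \<in> set_pmf PB" for y
      using that set_Pi_pmf_subset[of B d p] by (auto simp: R_def PB_def fun_eq_iff)
    have eq: "measure_pmf.expectation PB (\<lambda>y. \<phi> (R y)) = measure_pmf.expectation PB \<phi>"
      for \<phi> :: "('a \<Rightarrow> 'b) \<Rightarrow> real"
      by (intro integral_cong_AE) (auto simp: AE_measure_pmf_iff R)
    have gx: "measure_pmf.expectation PB (\<lambda>y. f (h x y)) = g x"
      by (simp add: g_def)
    have "measure_pmf.expectation PB (\<lambda>y. exp (l * (f (h x (R y)) -
          measure_pmf.expectation PB (\<lambda>y. f (h x (R y)))))) \<le> exp (l\<^sup>2 / 8)"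
    proof (rule Hoeffdings_lemma_pmf)
      show "\<bar>f (h x (R y)) - f (h x (R z))\<bar> \<le> 1" for y z
        by (rule Suc.prems(5)[of k]) (auto simp: R_def h_def B_def)
    qed (use Suc.prems(4) in auto)
    then have "measure_pmf.expectation PB (\<lambda>y. exp (l * (f (h x y) - g x))) \<le> exp (l\<^sup>2 / 8)"
      unfolding eq[of "\<lambda>y. f (h x y)"] gx
      unfolding eq[of "\<lambda>y. exp (l * (f (h x y) - g x))"] .
    then have "exp (l * (g x - \<mu>)) * measure_pmf.expectation PB (\<lambda>y. exp (l * (f (h x y) - g x)))
        \<le> exp (l * (g x - \<mu>)) * exp (l\<^sup>2 / 8)" by simp
    also have "exp (l * (g x - \<mu>)) * measure_pmf.expectation PB (\<lambda>y. exp (l * (f (h x y) - g x)))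
        = measure_pmf.expectation PB (\<lambda>y. exp (l * (f (h x y) - \<mu>)))"
      by (subst integral_mult_right_zero[symmetric])
         (simp add: exp_add[symmetric] algebra_simps)
    finally show ?thesis .
  qed
  have "measure_pmf.expectation (Pi_pmf E d p) (\<lambda>x. exp (l * (f x - \<mu>))) \<le>
     measure_pmf.expectation PA (\<lambda>x. exp (l * (g x - \<mu>)) * exp (l\<^sup>2 / 8))"
    unfolding split by (intro expectation_mono_finite inner) auto
  also have "\<dots> = measure_pmf.expectation PA (\<lambda>x. exp (l * (g x - \<mu>))) * exp (l\<^sup>2 / 8)"
    by simp
  also have "\<dots> \<le> exp (l\<^sup>2 * real k / 8) * exp (l\<^sup>2 / 8)"
    using IH by simp
  also have "\<dots> = exp (l\<^sup>2 * real (Suc k) / 8)"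
    by (simp add: exp_add[symmetric] field_simps)
  finally show ?case unfolding Ef \<mu>_def .
qed

text \<open>Multiplying the Chernoff bounds for the two tails cancels the unknown mean \<mu>. A
  lower bound on the upper tail thus yields an upper bound on the lower tail without any knowledge
  of \<mu>.\<close>

lemma bounded_differences_two_sided:
  fixes f :: "('a \<Rightarrow> 'b) \<Rightarrow> real" and c :: "'a \<Rightarrow> nat"
  assumes E: "finite E" "\<And>e. finite (set_pmf (p e))" "c ` E \<subseteq> {..<k}" and k: "k > 0" and t: "t > 0"
    and f: "\<And>j x y. (\<And>e. e \<notin> E \<or> c e \<noteq> j \<Longrightarrow> x e = y e) \<Longrightarrow> \<bar>f x - f y\<bar> \<le> 1"
  shows "measure_pmf.prob (Pi_pmf E d p) {x. f x \<le> a} *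
         measure_pmf.prob (Pi_pmf E d p) {x. f x \<ge> a + t} \<le> exp (- t\<^sup>2 / k)"
proof -
  define M where "M = Pi_pmf E d p"
  define \<mu> where "\<mu> = measure_pmf.expectation M f"
  \<comment> \<open>This value minimises the exponent \<open>- l * t + l^2 * k / 4\<close> of the
    product.\<close>
  define l where "l = 2 * t / k"
  have l: "l > 0" using k t by (simp add: l_def)
  have fin: "finite (set_pmf M)" unfolding M_def by (intro finite_set_Pi_pmf E)
  have markov: "measure_pmf.prob M {x. \<phi> x \<ge> b} \<le> exp (- l * b) * measure_pmf.expectation M (\<lambda>x. exp (l * \<phi> x))"
    for \<phi> :: "('a \<Rightarrow> 'b) \<Rightarrow> real" and b
  proof -
    have "measure_pmf.prob M {x. \<phi> x \<ge> b} = measure_pmf.expectation M (indicator {x. \<phi> x \<ge> b})"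
      by simp
    also have "\<dots> \<le> measure_pmf.expectation M (\<lambda>x. exp (- l * b) * exp (l * \<phi> x))"
      by (intro expectation_mono_finite fin)
         (use l in \<open>auto simp: indicator_def exp_add[symmetric]\<close>)
    finally show ?thesis by simp
  qed
  have mgf1: "measure_pmf.expectation M (\<lambda>x. exp (l * (f x - \<mu>))) \<le> exp (l\<^sup>2 * real k / 8)"
    unfolding M_def \<mu>_def
  proof (rule bounded_differences_mgf[where c = c])
    show "\<bar>f x - f y\<bar> \<le> 1" if "\<And>e. e \<notin> E \<or> c e \<noteq> j \<Longrightarrow> x e = y e" for j x y
      by (rule f[of j]) (rule that)
  qed fact+
  have mgf2: "measure_pmf.expectation M (\<lambda>x. exp (l * (- f x - measure_pmf.expectation M (\<lambda>x. - f x))))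
      \<le> exp (l\<^sup>2 * real k / 8)"
    unfolding M_def
  proof (rule bounded_differences_mgf[where c = c])
    show "\<bar>- f x - - f y\<bar> \<le> 1" if "\<And>e. e \<notin> E \<or> c e \<noteq> j \<Longrightarrow> x e = y e" for j x y
      using f[of j x y, OF that] by (simp add: abs_minus_commute)
  qed fact+
  have 1: "measure_pmf.prob M {x. f x - \<mu> \<ge> a + t - \<mu>} \<le> exp (- l * (a + t - \<mu>)) * exp (l\<^sup>2 * real k / 8)"
    by (rule order_trans[OF markov]) (use mgf1 in simp)
  have 2: "measure_pmf.prob M {x. - f x - - \<mu> \<ge> - a + \<mu>} \<le> exp (- l * (- a + \<mu>)) * exp (l\<^sup>2 * real k / 8)"
    by (rule order_trans[OF markov]) (use mgf2 in \<open>simp add: \<mu>_def\<close>)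
  have "measure_pmf.prob M {x. f x \<le> a} * measure_pmf.prob M {x. f x \<ge> a + t} \<le>
    (exp (- l * (- a + \<mu>)) * exp (l\<^sup>2 * real k / 8)) * (exp (- l * (a + t - \<mu>)) * exp (l\<^sup>2 * real k / 8))"
    using 1 2 by (intro mult_mono) (auto simp: algebra_simps)
  also have "\<dots> = exp (- l * t + l\<^sup>2 * k / 4)"
    by (simp add: exp_add[symmetric] algebra_simps)
  also have "- l * t + l\<^sup>2 * k / 4 = - t\<^sup>2 / k"
    using k by (simp add: l_def power2_eq_square field_simps)
  finally show ?thesis unfolding M_def .
qed

subsection \<open>Transversal cliques\<close>

lemma prob_Pi_pmf_bernoulli_all:
  assumes "finite E" "S \<subseteq> E" "0 \<le> p" "p \<le> 1"
  shows "measure_pmf.prob (Pi_pmf E d (\<lambda>_. bernoulli_pmf p)) {B. \<forall>e\<in>S. B e} = p ^ card S"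
proof -
  have "{B. \<forall>e\<in>S. B e} = Pi E (\<lambda>e. if e \<in> S then {True} else UNIV)"
    using assms(2) by (auto simp: Pi_def)
  then have "measure_pmf.prob (Pi_pmf E d (\<lambda>_. bernoulli_pmf p)) {B. \<forall>e\<in>S. B e} =
      (\<Prod>e\<in>E. if e \<in> S then p else 1)"
    using assms by (simp add: measure_Pi_pmf_Pi measure_pmf_single if_distrib cong: if_cong prod.cong)
  also have "\<dots> = (\<Prod>e\<in>S. p)"
    using assms by (intro prod.mono_neutral_cong_right) auto
  finally show ?thesis by simp
qed

text \<open>Replacing the quadratic exponent by one linear in \<open>l\<close> lets the second
  moment of the number of transversal cliques factor over the blocks.\<close>

lemma choose_2_le_half_mult:
  assumes "l \<le> k"
  shows "2 * (l choose 2) \<le> l * k"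
proof -
  have "2 * (l choose 2) = l * (l - 1)"
    using choose_two[of l] by (cases "even l") auto
  also have "\<dots> \<le> l * k" using assms by (intro mult_le_mono) auto
  finally show ?thesis .
qed

text \<open>A form of the Cauchy-Schwarz bound, derived from the pointwise inequality
  \<open>2 X \<le> X^2 / b + b\<close> where \<open>X\<close> is positive. The choice
  \<open>b = m * c\<close> makes the second moment divided by \<open>b\<close> at most
  \<open>m\<close>.\<close>

lemma second_moment_positive:
  fixes X :: "'a \<Rightarrow> real"
  assumes fin: "finite (set_pmf M)" and m: "measure_pmf.expectation M X = m" "m > 0"
    and s: "measure_pmf.expectation M (\<lambda>x. (X x)\<^sup>2) \<le> m\<^sup>2 * c" and c: "c > 0"
  shows "measure_pmf.prob M {x. X x > 0} \<ge> 1 / c"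
proof -
  define b where "b = m * c"
  have b: "b > 0" using m c by (simp add: b_def)
  have pt: "X x \<le> ((X x)\<^sup>2 / b + b * indicator {x. X x > 0} x) / 2" for x
  proof (cases "X x > 0")
    case True
    have "0 \<le> (X x - b)\<^sup>2 / b" using b by simp
    also have "(X x - b)\<^sup>2 / b = (X x)\<^sup>2 / b + b - 2 * X x"
      using b by (simp add: power2_eq_square field_simps)
    finally show ?thesis using True by simp
  next
    case False
    then show ?thesis using b by (auto intro: order_trans[of _ 0])
  qed
  note int [simp] = integrable_measure_pmf_finite[OF fin]
  have "m \<le> measure_pmf.expectation M (\<lambda>x. ((X x)\<^sup>2 / b + b * indicator {x. X x > 0} x) / 2)"
    unfolding m(1)[symmetric] by (intro expectation_mono_finite fin pt)
  also have "\<dots> = (measure_pmf.expectation M (\<lambda>x. (X x)\<^sup>2) / b + b * measure_pmf.prob M {x. X x > 0}) / 2"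
    by (simp add: Bochner_Integration.integral_add)
  also have "\<dots> \<le> (m\<^sup>2 * c / b + b * measure_pmf.prob M {x. X x > 0}) / 2"
    using s b by (intro divide_right_mono add_right_mono) auto
  also have "m\<^sup>2 * c / b = m" using m c by (simp add: b_def power2_eq_square)
  finally have "m \<le> b * measure_pmf.prob M {x. X x > 0}" by simp
  then show ?thesis using m c by (simp add: b_def field_simps)
qed

text \<open>Second moment method for the number of transversal cliques. Two choices agreeing in
  \<open>l\<close> blocks share \<open>l choose 2\<close> pairs, which raises their joint
  probability by at most \<open>w ^ l\<close>. Averaged over the second choice this gives
  \<open>((w + s - 1) / s) ^ k \<le> exp (k * w / s)\<close>.\<close>

lemma transversal_clique_probability:
  fixes V :: "nat \<Rightarrow> nat set" and p :: real
  assumes W: "finite W" and V: "\<And>i. i < k \<Longrightarrow> V i \<subseteq> W" "\<And>i. i < k \<Longrightarrow> card (V i) = s"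
    and dis: "\<And>i j. i < k \<Longrightarrow> j < k \<Longrightarrow> i \<noteq> j \<Longrightarrow> V i \<inter> V j = {}"
    and s: "s > 0" and p: "0 < p" "p \<le> 1"
  shows "measure_pmf.prob (Pi_pmf (nsets W 2) d (\<lambda>_. bernoulli_pmf p))
      {B. \<exists>\<phi>\<in>PiE {..<k} V. \<forall>e\<in>nsets (\<phi> ` {..<k}) 2. B e} \<ge> exp (- (k * sqrt (1 / p) ^ k / s))"
proof -
  define M where "M = Pi_pmf (nsets W 2) d (\<lambda>_. bernoulli_pmf p)"
  define \<Phi> where "\<Phi> = PiE {..<k} V"
  define S where "S = (\<lambda>\<phi>::nat\<Rightarrow>nat. nsets (\<phi> ` {..<k}) 2)"
  \<comment> \<open>\<open>w\<close> bounds the gain per common vertex: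
    \<open>(1 / p) ^ (l choose 2) \<le> w ^ l\<close> for \<open>l \<le> k\<close>.\<close>
  define w where "w = sqrt (1 / p) ^ k"
  define c where "c = k choose 2"
  have finE: "finite (nsets W 2)" using W by (rule finite_imp_finite_nsets)
  have finM: "finite (set_pmf M)" unfolding M_def by (intro finite_set_Pi_pmf finE) auto
  have finV: "finite (V i)" if "i < k" for i using V(1)[OF that] W finite_subset by blast
  have fin\<Phi>: "finite \<Phi>" unfolding \<Phi>_def using finV by (intro finite_PiE) auto
  have card\<Phi>: "card \<Phi> = s ^ k" unfolding \<Phi>_def using V(2) by (simp add: card_PiE)
  have mem: "\<phi> i \<in> V i" if "\<phi> \<in> \<Phi>" "i < k" for \<phi> i using that by (auto simp: \<Phi>_def)
  \<comment> \<open>Blocks are disjoint, so a vertex common to two choices sits at the same index in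
    both. The overlap of their images is therefore the set of indices where they agree.\<close>
  have cross: "i = j" if "\<phi> \<in> \<Phi>" "\<psi> \<in> \<Phi>" "i < k" "j < k" "\<phi> i = \<psi> j" for \<phi> \<psi> i j
    using mem[OF that(1,3)] mem[OF that(2,4)] dis[OF that(3,4)] that(5) by auto
  have inj: "inj_on \<phi> {..<k}" if "\<phi> \<in> \<Phi>" for \<phi>
    using cross[OF that that] by (auto simp: inj_on_def)
  have cardT: "card (\<phi> ` {..<k}) = k" if "\<phi> \<in> \<Phi>" for \<phi>
    using inj[OF that] by (simp add: card_image)
  have SE: "S \<phi> \<subseteq> nsets W 2" if "\<phi> \<in> \<Phi>" for \<phi>
    unfolding S_def using mem[OF that] V(1) by (intro nsets_mono) auto
  have cardS: "card (S \<phi>) = c" if "\<phi> \<in> \<Phi>" for \<phi>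
    using cardT[OF that] by (simp add: S_def c_def)
  define l where "l = (\<lambda>\<phi> \<psi>::nat\<Rightarrow>nat. card {i\<in>{..<k}. \<phi> i = \<psi> i})"
  have w1: "w \<ge> 1" unfolding w_def using p by (intro one_le_power) simp
  have pow: "p ^ card (S \<phi> \<union> S \<psi>) \<le> p ^ (2 * c) * w ^ l \<phi> \<psi>" if \<phi>: "\<phi> \<in> \<Phi>" and \<psi>: "\<psi> \<in> \<Phi>" for \<phi> \<psi>
  proof -
    have "\<phi> ` {..<k} \<inter> \<psi> ` {..<k} = \<phi> ` {i\<in>{..<k}. \<phi> i = \<psi> i}"
      using cross[OF \<phi> \<psi>] by fastforce
    then have "card (\<phi> ` {..<k} \<inter> \<psi> ` {..<k}) = l \<phi> \<psi>"
      using inj_on_subset[OF inj[OF \<phi>]] unfolding l_def by (metis (lifting) card_image mem_Collect_eq subsetI)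
    moreover have "S \<phi> \<inter> S \<psi> = nsets (\<phi> ` {..<k} \<inter> \<psi> ` {..<k}) 2"
      by (auto simp: S_def nsets_def)
    ultimately have int: "card (S \<phi> \<inter> S \<psi>) = l \<phi> \<psi> choose 2" by simp
    have fS: "finite (S \<phi>)" "finite (S \<psi>)" using SE \<phi> \<psi> finE finite_subset by blast+
    have un: "card (S \<phi> \<union> S \<psi>) + (l \<phi> \<psi> choose 2) = 2 * c"
      using card_Un_Int[OF fS] cardS[OF \<phi>] cardS[OF \<psi>] int by simp
    have lk: "l \<phi> \<psi> \<le> k" unfolding l_def by (rule order_trans[OF card_mono[of "{..<k}"]]) auto
    have r: "1 \<le> sqrt (1 / p)" using p by simp
    have "(1 / p) ^ (l \<phi> \<psi> choose 2) = sqrt (1 / p) ^ (2 * (l \<phi> \<psi> choose 2))"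
      using p by (simp add: power_mult)
    also have "\<dots> \<le> sqrt (1 / p) ^ (l \<phi> \<psi> * k)"
      by (intro power_increasing choose_2_le_half_mult lk r)
    also have "\<dots> = w ^ l \<phi> \<psi>" by (simp add: w_def power_mult[symmetric] mult.commute)
    finally have "(1 / p) ^ (l \<phi> \<psi> choose 2) \<le> w ^ l \<phi> \<psi>" .
    moreover have "p ^ card (S \<phi> \<union> S \<psi>) = p ^ (2 * c) * (1 / p) ^ (l \<phi> \<psi> choose 2)"
      unfolding un[symmetric] using p by (simp add: power_add power_divide)
    ultimately show ?thesis using p by simp
  qed
  \<comment> \<open>\<open>X\<close> counts the transversal cliques.\<close>
  define X where "X = (\<lambda>B. \<Sum>\<phi>\<in>\<Phi>. indicator {B. \<forall>e\<in>S \<phi>. B e} B :: real)"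
  note int [simp] = integrable_measure_pmf_finite[OF finM]
  have EX: "measure_pmf.expectation M X = s ^ k * p ^ c"
  proof -
    have "measure_pmf.expectation M X = (\<Sum>\<phi>\<in>\<Phi>. measure_pmf.prob M {B. \<forall>e\<in>S \<phi>. B e})"
      unfolding X_def by (subst Bochner_Integration.integral_sum) auto
    also have "\<dots> = (\<Sum>\<phi>\<in>\<Phi>. p ^ c)"
      unfolding M_def using p cardS by (intro sum.cong refl) (simp add: prob_Pi_pmf_bernoulli_all[OF finE SE])
    finally show ?thesis by (simp add: card\<Phi>)
  qed
  have "measure_pmf.expectation M (\<lambda>B. (X B)\<^sup>2) =
      (\<Sum>\<phi>\<in>\<Phi>. \<Sum>\<psi>\<in>\<Phi>. measure_pmf.prob M {B. \<forall>e\<in>S \<phi> \<union> S \<psi>. B e})"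
  proof -
    have "(X B)\<^sup>2 = (\<Sum>\<phi>\<in>\<Phi>. \<Sum>\<psi>\<in>\<Phi>. indicator {B. \<forall>e\<in>S \<phi> \<union> S \<psi>. B e} B)" for B
      unfolding X_def power2_eq_square sum_product
      by (intro sum.cong refl) (auto simp: indicator_def)
    then show ?thesis by (simp add: Bochner_Integration.integral_sum)
  qed
  also have "\<dots> \<le> (\<Sum>\<phi>\<in>\<Phi>. \<Sum>\<psi>\<in>\<Phi>. p ^ (2 * c) * w ^ l \<phi> \<psi>)"
  proof (intro sum_mono)
    fix \<phi> \<psi> assume "\<phi> \<in> \<Phi>" "\<psi> \<in> \<Phi>"
    then show "measure_pmf.prob M {B. \<forall>e\<in>S \<phi> \<union> S \<psi>. B e} \<le> p ^ (2 * c) * w ^ l \<phi> \<psi>"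
      using pow SE p unfolding M_def by (subst prob_Pi_pmf_bernoulli_all[OF finE]) auto
  qed
  also have "\<dots> = (\<Sum>\<phi>\<in>\<Phi>. p ^ (2 * c) * (w + s - 1) ^ k)"
  proof (intro sum.cong refl)
    fix \<phi> assume \<phi>: "\<phi> \<in> \<Phi>"
    \<comment> \<open>As a product over blocks, the sum over all \<psi> factors: in each block one
      vertex agrees with \<phi> and has weight \<open>w\<close>, the other \<open>s - 1\<close> have
      weight 1.\<close>
    have "w ^ l \<phi> \<psi> = (\<Prod>i<k. if \<phi> i = \<psi> i then w else 1)" for \<psi>
      by (subst prod.inter_filter[symmetric]) (simp_all add: l_def)
    then have "(\<Sum>\<psi>\<in>\<Phi>. w ^ l \<phi> \<psi>) = (\<Sum>\<psi>\<in>\<Phi>. \<Prod>i<k. if \<phi> i = \<psi> i then w else 1)" by simp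
    also have "\<dots> = (\<Prod>i<k. \<Sum>a\<in>V i. if \<phi> i = a then w else 1)"
      unfolding \<Phi>_def using finV by (subst prod_sum_PiE) auto
    also have "\<dots> = (\<Prod>i<k. w + s - 1)"
    proof (intro prod.cong refl)
      fix i assume "i \<in> {..<k}"
      then have i: "i < k" by simp
      have "(\<Sum>a\<in>V i. if \<phi> i = a then w else 1) = w + (\<Sum>a\<in>V i - {\<phi> i}. 1)"
        using mem[OF \<phi> i] finV[OF i] by (subst sum.remove[of _ "\<phi> i"]) (auto intro!: sum.cong)
      also have "\<dots> = w + s - 1"
        using mem[OF \<phi> i] finV[OF i] V(2)[OF i] s by simp
      finally show "(\<Sum>a\<in>V i. if \<phi> i = a then w else 1) = w + s - 1" .
    qed
    finally show "(\<Sum>\<psi>\<in>\<Phi>. p ^ (2 * c) * w ^ l \<phi> \<psi>) = p ^ (2 * c) * (w + s - 1) ^ k"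
      by (simp add: sum_distrib_left[symmetric])
  qed
  also have "\<dots> = s ^ k * p ^ (2 * c) * (w + s - 1) ^ k" by (simp add: card\<Phi>)
  also have "\<dots> = (s ^ k * p ^ c)\<^sup>2 * ((w + s - 1) / s) ^ k"
    using s by (simp add: power_divide power_mult power2_eq_square power_mult_distrib field_simps)
  also have "\<dots> \<le> (s ^ k * p ^ c)\<^sup>2 * exp (k * w / s)"
  proof (intro mult_left_mono)
    have "((w + s - 1) / s) ^ k \<le> exp (w / s) ^ k"
    proof (rule power_mono)
      have "(w + s - 1) / s \<le> 1 + w / s" using s by (simp add: field_simps)
      also have "\<dots> \<le> exp (w / s)" by (rule exp_ge_add_one_self)
      finally show "(w + s - 1) / s \<le> exp (w / s)" .
      show "0 \<le> (w + s - 1) / s" using w1 s by auto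
    qed
    then show "((w + s - 1) / s) ^ k \<le> exp (k * w / s)" by (simp add: exp_of_nat_mult[symmetric])
  qed simp
  finally have E2: "measure_pmf.expectation M (\<lambda>B. (X B)\<^sup>2) \<le> (s ^ k * p ^ c)\<^sup>2 * exp (k * w / s)" .
  have "measure_pmf.prob M {B. X B > 0} \<ge> 1 / exp (k * w / s)"
    by (rule second_moment_positive[OF finM EX _ E2]) (use s p in auto)
  moreover have "{B. X B > 0} \<subseteq> {B. \<exists>\<phi>\<in>\<Phi>. \<forall>e\<in>S \<phi>. B e}"
  proof safe
    fix B assume "X B > 0"
    then obtain \<phi> where "\<phi> \<in> \<Phi>" "indicator {B. \<forall>e\<in>S \<phi>. B e} B \<noteq> (0::real)"
      unfolding X_def by (metis (no_types, lifting) less_irrefl sum.neutral)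
    then show "\<exists>\<phi>\<in>\<Phi>. \<forall>e\<in>S \<phi>. B e" by (auto simp: indicator_def split: if_splits)
  qed
  then have "measure_pmf.prob M {B. X B > 0} \<le> measure_pmf.prob M {B. \<exists>\<phi>\<in>\<Phi>. \<forall>e\<in>S \<phi>. B e}"
    by (intro measure_pmf.finite_measure_mono) auto
  moreover have "exp (- (k * w / s)) = 1 / exp (k * w / s)"
    by (simp add: exp_minus inverse_eq_divide)
  ultimately have "exp (- (k * w / s)) \<le> measure_pmf.prob M {B. \<exists>\<phi>\<in>\<Phi>. \<forall>e\<in>S \<phi>. B e}"
    by linarith
  then show ?thesis unfolding M_def \<Phi>_def S_def w_def .
qed

section \<open>The largest partial transversal clique and its lower tail\<close>

text \<open>\<open>b\<close> is the block index, so injectivity of \<open>b\<close> on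
  \<open>T\<close> means at most one vertex per block. Blocks may be skipped, which is why
  resampling one block costs at most one vertex.\<close>

definition max_partial_transversal :: "('v \<Rightarrow> nat) \<Rightarrow> 'v set \<Rightarrow> ('v set \<Rightarrow> bool) \<Rightarrow> nat" where
  "max_partial_transversal b U B = Max (card ` {T. T \<subseteq> U \<and> inj_on b T \<and> (\<forall>e\<in>nsets T 2. B e)})"

lemma max_partial_transversal_ge:
  assumes "finite U" "T \<subseteq> U" "inj_on b T" "\<forall>e\<in>nsets T 2. B e"
  shows "card T \<le> max_partial_transversal b U B"
  unfolding max_partial_transversal_def using assms by (intro Max_ge) auto

lemma max_partial_transversal_obtain:
  assumes "finite U"
  obtains T where "T \<subseteq> U" "inj_on b T" "\<forall>e\<in>nsets T 2. B e" "card T = max_partial_transversal b U B"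
proof -
  let ?A = "{T. T \<subseteq> U \<and> inj_on b T \<and> (\<forall>e\<in>nsets T 2. B e)}"
  have "{} \<in> ?A" by (auto simp: nsets_def)
  then have "Max (card ` ?A) \<in> card ` ?A" using assms by (intro Max_in) auto
  then show ?thesis using that unfolding max_partial_transversal_def by auto
qed

text \<open>The coin of a pair \<open>e\<close> is attributed to the last block \<open>Max (b ` e)\<close> that it meets. Changing
  the coins of block \<open>j\<close> then affects only pairs with a vertex in block \<open>j\<close>, so dropping the one
  vertex of a partial transversal in that block suffices.\<close>

lemma max_partial_transversal_change_block:
  assumes U: "finite U" "U \<subseteq> W" and xy: "\<And>e. e \<notin> nsets W 2 \<or> Max (b ` e) \<noteq> j \<Longrightarrow> x e = y e"
  shows "max_partial_transversal b U x \<le> max_partial_transversal b U y + 1"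
proof -
  obtain T where T: "T \<subseteq> U" "inj_on b T" "\<forall>e\<in>nsets T 2. x e" "card T = max_partial_transversal b U x"
    using max_partial_transversal_obtain[OF U(1)] by metis
  define T' where "T' = {v\<in>T. b v \<noteq> j}"
  have "card (T - T') \<le> card {j}"
    by (rule card_inj_on_le[of b]) (use T(2) in \<open>auto simp: T'_def inj_on_def\<close>)
  moreover have "T' \<union> (T - T') = T" by (auto simp: T'_def)
  then have "card T \<le> card T' + card (T - T')" using card_Un_le[of T' "T - T'"] by simp
  moreover have "card T' \<le> max_partial_transversal b U y"
  proof (rule max_partial_transversal_ge[OF U(1)])
    show "\<forall>e\<in>nsets T' 2. y e"
    proof
      fix e assume e: "e \<in> nsets T' 2"
      then obtain u v where uv: "e = {u, v}" "u \<in> T'" "v \<in> T'" "u \<noteq> v" by (auto elim: nsets2_E)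
      then have "x e" using T(3) by (auto simp: T'_def)
      moreover have "Max (b ` e) \<noteq> j" using uv by (auto simp: T'_def max_def)
      ultimately show "y e" using xy by blast
    qed
  qed (use T in \<open>auto simp: T'_def intro: inj_on_subset\<close>)
  ultimately show ?thesis using T(4) by simp
qed

text \<open>The statistic changes by at most 1 per block, so bounded differences control the product
  of its two tails. The upper tail at level \<open>k\<close> is at least the probability of a full
  transversal clique; dividing by that bound leaves the lower tail.\<close>

lemma large_clique_lower_tail:
  fixes b :: "nat \<Rightarrow> nat" and p t :: real
  assumes W: "finite W" "U \<subseteq> W" and b: "\<And>v. v \<in> W \<Longrightarrow> b v < k"
    and s: "\<And>i. i < k \<Longrightarrow> card {v\<in>U. b v = i} = s" "s > 0" and p: "0 < p" "p \<le> 1"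
    and k: "k > 0" and t: "t > 0"
  shows "measure_pmf.prob (Pi_pmf (nsets W 2) d (\<lambda>_. bernoulli_pmf p))
      {B. \<not> (\<exists>T\<subseteq>U. k - t \<le> card T \<and> (\<forall>e\<in>nsets T 2. B e))}
    \<le> exp (k * sqrt (1 / p) ^ k / s - t\<^sup>2 / k)"
proof -
  define M where "M = Pi_pmf (nsets W 2) d (\<lambda>_. bernoulli_pmf p)"
  define f where "f = (\<lambda>B. real (max_partial_transversal b U B))"
  have U: "finite U" using W finite_subset by blast
  \<comment> \<open>The upper level \<open>(k - t) + t\<close> is \<open>k\<close>, attained by full
    transversals.\<close>
  have a: "measure_pmf.prob M {B. f B \<le> k - t} * measure_pmf.prob M {B. f B \<ge> (k - t) + t}
      \<le> exp (- t\<^sup>2 / k)"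
    unfolding M_def
  proof (rule bounded_differences_two_sided[where c = "\<lambda>e. Max (b ` e)"])
    show "(\<lambda>e. Max (b ` e)) ` nsets W 2 \<subseteq> {..<k}"
      using b by (auto elim!: nsets2_E)
    show "\<bar>f x - f y\<bar> \<le> 1" if "\<And>e. e \<notin> nsets W 2 \<or> Max (b ` e) \<noteq> j \<Longrightarrow> x e = y e" for j x y
    proof -
      have "y e = x e" if "e \<notin> nsets W 2 \<or> Max (b ` e) \<noteq> j" for e
        using \<open>e \<notin> nsets W 2 \<or> Max (b ` e) \<noteq> j \<Longrightarrow> x e = y e\<close> that by simp
      then have "max_partial_transversal b U y \<le> max_partial_transversal b U x + 1"
        by (rule max_partial_transversal_change_block[OF U W(2), where j = j])
      moreover have "max_partial_transversal b U x \<le> max_partial_transversal b U y + 1"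
        by (rule max_partial_transversal_change_block[OF U W(2), where j = j]) (rule that)
      ultimately show ?thesis unfolding f_def by linarith
    qed
  qed (use k t W(1) in \<open>auto intro: finite_imp_finite_nsets\<close>)
  define V where "V = (\<lambda>i. {v\<in>U. b v = i})"
  have "exp (- (k * sqrt (1 / p) ^ k / s)) \<le> measure_pmf.prob M
      {B. \<exists>\<phi>\<in>PiE {..<k} V. \<forall>e\<in>nsets (\<phi> ` {..<k}) 2. B e}"
    unfolding M_def
    by (rule transversal_clique_probability) (use W s p in \<open>auto simp: V_def\<close>)
  also have "\<dots> \<le> measure_pmf.prob M {B. f B \<ge> (k - t) + t}"
  proof (intro measure_pmf.finite_measure_mono subsetI; clarsimp)
    fix B \<phi> assume \<phi>: "\<phi> \<in> PiE {..<k} V" and B: "\<forall>e\<in>nsets (\<phi> ` {..<k}) 2. B e"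
    have b\<phi>: "b (\<phi> i) = i" "\<phi> i \<in> U" if "i < k" for i using \<phi> that by (auto simp: V_def)
    then have "inj_on \<phi> {..<k}" by (intro inj_on_inverseI[of _ b]) auto
    then have "card (\<phi> ` {..<k}) = k" by (simp add: card_image)
    moreover have "card (\<phi> ` {..<k}) \<le> max_partial_transversal b U B"
      by (rule max_partial_transversal_ge[OF U _ _ B]) (use b\<phi> in \<open>auto simp: inj_on_def\<close>)
    ultimately show "real k \<le> f B" by (simp add: f_def)
  qed
  finally have l: "exp (- (k * sqrt (1 / p) ^ k / s)) \<le> measure_pmf.prob M {B. f B \<ge> (k - t) + t}" .
  have "measure_pmf.prob M {B. f B \<le> k - t} * exp (- (k * sqrt (1 / p) ^ k / s)) \<le> exp (- t\<^sup>2 / k)"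
    by (rule order_trans[OF mult_left_mono[OF l] a]) simp
  then have "measure_pmf.prob M {B. f B \<le> k - t} \<le> exp (- t\<^sup>2 / k) * exp (k * sqrt (1 / p) ^ k / s)"
    by (simp add: exp_minus field_simps)
  also have "\<dots> = exp (k * sqrt (1 / p) ^ k / s - t\<^sup>2 / k)"
    by (simp add: exp_add[symmetric])
  finally have "measure_pmf.prob M {B. f B \<le> k - t} \<le> exp (k * sqrt (1 / p) ^ k / s - t\<^sup>2 / k)" .
  moreover have "{B. \<not> (\<exists>T\<subseteq>U. k - t \<le> card T \<and> (\<forall>e\<in>nsets T 2. B e))} \<subseteq> {B. f B \<le> k - t}"
  proof
    fix B assume "B \<in> {B. \<not> (\<exists>T\<subseteq>U. k - t \<le> card T \<and> (\<forall>e\<in>nsets T 2. B e))}"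
    then have B: "\<forall>T\<subseteq>U. k - t \<le> card T \<longrightarrow> \<not> (\<forall>e\<in>nsets T 2. B e)"
      by blast
    obtain T where T: "T \<subseteq> U" "\<forall>e\<in>nsets T 2. B e" "card T = max_partial_transversal b U B"
      using max_partial_transversal_obtain[OF U] by metis
    then have "\<not> k - t \<le> card T" using B by blast
    then show "B \<in> {B. f B \<le> k - t}" by (simp add: f_def T(3))
  qed
  then have "measure_pmf.prob M {B. \<not> (\<exists>T\<subseteq>U. k - t \<le> card T \<and> (\<forall>e\<in>nsets T 2. B e))}
      \<le> measure_pmf.prob M {B. f B \<le> k - t}"
    by (intro measure_pmf.finite_measure_mono) auto
  ultimately show ?thesis unfolding M_def by linarith
qed

section \<open>From product measures of coins to \<open>Pi_pmf\<close>\<close>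

text \<open>Both sides agree on boxes, which determines the product measure. \<open>Pi_pmf\<close>
  takes the value \<open>d\<close> outside \<open>A\<close> while product spaces take
  \<open>undefined\<close>; \<open>restrict\<close> reconciles the two conventions.\<close>

lemma PiM_measure_pmf_conv_Pi_pmf:
  fixes p :: "'a \<Rightarrow> 'b pmf"
  assumes [simp]: "finite A"
  shows "(\<Pi>\<^sub>M i\<in>A. measure_pmf (p i)) =
    distr (Pi_pmf A d p) (\<Pi>\<^sub>M i\<in>A. measure_pmf (p i)) (\<lambda>x. restrict x A)"
proof -
  interpret product_sigma_finite "\<lambda>i. measure_pmf (p i)"
    by standard
  have m: "(\<lambda>x. restrict x A) \<in> measurable (measure_pmf (Pi_pmf A d p)) (\<Pi>\<^sub>M i\<in>A. measure_pmf (p i))"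
    by (auto simp: space_PiM)
  show ?thesis
  proof (rule PiM_eqI[symmetric])
    fix F assume "\<And>i. i \<in> A \<Longrightarrow> F i \<in> sets (measure_pmf (p i))"
    have "Pi\<^sub>E A F \<in> sets (\<Pi>\<^sub>M i\<in>A. measure_pmf (p i))" by (intro sets_PiM_I_finite) auto
    then have "emeasure (distr (Pi_pmf A d p) (\<Pi>\<^sub>M i\<in>A. measure_pmf (p i)) (\<lambda>x. restrict x A)) (Pi\<^sub>E A F)
       = emeasure (Pi_pmf A d p) ((\<lambda>x. restrict x A) -` Pi\<^sub>E A F)"
      using m by (simp add: emeasure_distr)
    also have "(\<lambda>x. restrict x A) -` Pi\<^sub>E A F = Pi A F" by (auto simp: PiE_def Pi_def)
    also have "emeasure (Pi_pmf A d p) (Pi A F) = (\<Prod>i\<in>A. emeasure (measure_pmf (p i)) (F i))"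
      by (simp add: measure_pmf.emeasure_eq_measure measure_Pi_pmf_Pi prod_ennreal)
    finally show "emeasure (distr (Pi_pmf A d p) (\<Pi>\<^sub>M i\<in>A. measure_pmf (p i)) (\<lambda>x. restrict x A)) (Pi\<^sub>E A F)
       = (\<Prod>i\<in>A. emeasure (measure_pmf (p i)) (F i))" .
  qed auto
qed

lemma measure_PiM_measure_pmf:
  assumes "finite A" "S \<in> sets (\<Pi>\<^sub>M i\<in>A. measure_pmf (p i))"
  shows "measure (\<Pi>\<^sub>M i\<in>A. measure_pmf (p i)) S =
    measure_pmf.prob (Pi_pmf A d p) {x. restrict x A \<in> S}"
  by (subst PiM_measure_pmf_conv_Pi_pmf[OF assms(1), of p d], subst measure_distr)
     (use assms in \<open>auto simp: space_PiM vimage_def\<close>)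

subsection \<open>Random points on the torus\<close>

definition unit_square_measure :: "(real \<times> real) measure" where
  "unit_square_measure = uniform_measure lborel ({0..1} \<times> {0..1})"

lemma emeasure_lborel_Times:
  fixes A B :: "real set"
  assumes "A \<in> sets borel" "B \<in> sets borel"
  shows "emeasure lborel (A \<times> B) = emeasure lborel A * emeasure lborel B"
  using assms by (simp add: lborel_prod[symmetric] lborel.emeasure_pair_measure_Times)

lemma borel_Times_real [measurable, simp, intro]:
  fixes A B :: "real set"
  assumes "A \<in> sets borel" "B \<in> sets borel"
  shows "A \<times> B \<in> sets (borel :: (real \<times> real) measure)"
  using assms by (simp add: borel_prod[symmetric])

lemma sets_unit_square_measure [measurable_cong, simp]: "sets unit_square_measure = sets borel"
  by (simp add: unit_square_measure_def)

lemma space_unit_square_measure [simp]: "space unit_square_measure = UNIV"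
  by (simp add: unit_square_measure_def)

lemma emeasure_unit_square_measure:
  assumes "A \<in> sets borel"
  shows "emeasure unit_square_measure A = emeasure lborel (({0..1} \<times> {0..1}) \<inter> A)"
  using assms by (simp add: unit_square_measure_def emeasure_lborel_Times divide_ennreal_def)

lemma prob_space_unit_square_measure: "prob_space unit_square_measure"
  unfolding unit_square_measure_def
  by (intro prob_space_uniform_measure) (simp_all add: emeasure_lborel_Times)

lemma AE_unit_square_measure: "AE x in unit_square_measure. x \<in> {0..1} \<times> {0..1}"
  unfolding unit_square_measure_def by (rule AE_uniform_measureI) auto

lemma circle_dist_measurable [measurable]:
  assumes [measurable]: "f \<in> borel_measurable M" "g \<in> borel_measurable M"
  shows "(\<lambda>x. circle_dist (f x) (g x)) \<in> borel_measurable M"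
  unfolding circle_dist_def by measurable

lemma torus_dist_measurable [measurable]:
  assumes [measurable]: "f \<in> borel_measurable M" "g \<in> borel_measurable M"
  shows "(\<lambda>x. torus_dist (f x) (g x)) \<in> borel_measurable M"
proof -
  have "(fst :: real \<times> real \<Rightarrow> real) \<in> borel_measurable borel" "(snd :: real \<times> real \<Rightarrow> real) \<in> borel_measurable borel"
    by (intro borel_measurable_continuous_onI continuous_intros)+
  note [measurable] = measurable_compose[OF assms(1) this(1)] measurable_compose[OF assms(1) this(2)]
    measurable_compose[OF assms(2) this(1)] measurable_compose[OF assms(2) this(2)]
  show ?thesis unfolding torus_dist_def by measurable
qed

lemma torus_dist_commute: "torus_dist x y = torus_dist y x"
  by (simp add: torus_dist_def circle_dist_def abs_minus_commute)

text \<open>Each coordinate of a point of the ball lies in a set of length at most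
  \<open>4 * r\<close>, hence the crude area \<open>16 * r^2\<close>.\<close>

lemma emeasure_torus_ball_le:
  assumes x: "x \<in> {0..1} \<times> {0..1}" and r: "r \<ge> 0"
  shows "emeasure unit_square_measure {y. torus_dist x y \<le> r} \<le> ennreal (16 * r\<^sup>2)"
proof -
  \<comment> \<open>A coordinate within circle distance \<open>r\<close> of \<open>a\<close> is
    either within \<open>r\<close> of \<open>a\<close> on the line, or reached by wrapping around
    and then within \<open>r\<close> of 0 or 1. The lengths \<open>2 r\<close>, \<open>r\<close> and
    \<open>r\<close> add up to \<open>4 r\<close>.\<close>
  define I where "I = (\<lambda>a::real. {a - r..a + r} \<union> {0..r} \<union> {1 - r..1})"
  have I: "emeasure lborel (I a) \<le> ennreal (4 * r)" for a
  proof -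
    have "emeasure lborel (I a) \<le> emeasure lborel {a - r..a + r} + emeasure lborel {0..r} + emeasure lborel {1 - r..1}"
      unfolding I_def
      by (rule order_trans[OF emeasure_subadditive add_right_mono[OF emeasure_subadditive]]) auto
    also have "\<dots> = ennreal (4 * r)" using r by (simp add: ennreal_plus[symmetric] del: ennreal_plus)
    finally show ?thesis .
  qed
  have "({0..1} \<times> {0..1}) \<inter> {y. torus_dist x y \<le> r} \<subseteq> I (fst x) \<times> I (snd x)"
  proof (clarsimp, intro conjI)
    fix a b :: real assume ab: "0 \<le> a" "a \<le> 1" "0 \<le> b" "b \<le> 1" and d: "torus_dist x (a, b) \<le> r"
    have "circle_dist (fst x) a \<le> r" "circle_dist (snd x) b \<le> r"
      using d real_sqrt_sum_squares_ge1[of "circle_dist (fst x) a" "circle_dist (snd x) b"]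
        real_sqrt_sum_squares_ge2[of "circle_dist (snd x) b" "circle_dist (fst x) a"]
      unfolding torus_dist_def fst_conv snd_conv by linarith+
    moreover have "z \<in> I w" if "circle_dist w z \<le> r" "w \<in> {0..1}" "z \<in> {0..1}" for w z
      using that by (auto simp: circle_dist_def I_def min_def abs_if split: if_splits)
    ultimately show "a \<in> I (fst x)" "b \<in> I (snd x)"
      using ab x by auto
  qed
  then have "emeasure unit_square_measure {y. torus_dist x y \<le> r} \<le> emeasure lborel (I (fst x) \<times> I (snd x))"
    by (subst emeasure_unit_square_measure) (auto intro!: emeasure_mono simp: I_def)
  also have "\<dots> = emeasure lborel (I (fst x)) * emeasure lborel (I (snd x))"
    by (rule emeasure_lborel_Times) (auto simp: I_def)
  also have "\<dots> \<le> ennreal (4 * r) * ennreal (4 * r)"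
    by (intro mult_mono I) auto
  also have "\<dots> = ennreal (16 * r\<^sup>2)"
    using r by (simp add: ennreal_mult[symmetric] power2_eq_square)
  finally show ?thesis .
qed

definition points_measure :: "nat \<Rightarrow> (nat \<Rightarrow> real \<times> real) measure" where
  "points_measure n = (\<Pi>\<^sub>M i\<in>{..<n}. unit_square_measure)"

lemma prob_space_points_measure: "prob_space (points_measure n)"
  unfolding points_measure_def by (intro prob_space_PiM prob_space_unit_square_measure)

lemma product_sigma_finite_unit_square: "product_sigma_finite (\<lambda>i::nat. unit_square_measure)"
proof -
  interpret prob_space unit_square_measure by (rule prob_space_unit_square_measure)
  show ?thesis by standard
qed

lemma sets_points_measure_torus_dist [measurable]:
  assumes "i < n" "j < n"
  shows "(\<lambda>X. torus_dist (X i) (X j)) \<in> borel_measurable (points_measure n)"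
proof -
  have "(\<lambda>X. X i) \<in> points_measure n \<rightarrow>\<^sub>M unit_square_measure" "(\<lambda>X. X j) \<in> points_measure n \<rightarrow>\<^sub>M unit_square_measure"
    unfolding points_measure_def using assms by (auto intro: measurable_component_singleton)
  then have [measurable]: "(\<lambda>X. X i) \<in> borel_measurable (points_measure n)" "(\<lambda>X. X j) \<in> borel_measurable (points_measure n)"
    by (simp_all cong: measurable_cong_sets)
  show ?thesis by measurable
qed

text \<open>Once the point of \<open>v\<close> is fixed, the other points of \<open>S\<close> are
  independent and each hits the ball around it with probability at most \<open>16 * r^2\<close>. A
  star is used rather than a clique because its conditions become independent in this way.\<close>

lemma prob_star_le:
  assumes S: "S \<subseteq> {..<n}" "v \<in> S" and r: "r \<ge> 0"
  shows "emeasure (points_measure n) {X\<in>space (points_measure n). \<forall>j\<in>S - {v}. torus_dist (X v) (X j) \<le> r}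
    \<le> ennreal ((16 * r\<^sup>2) ^ (card S - 1))"
proof -
  interpret U: prob_space unit_square_measure by (rule prob_space_unit_square_measure)
  interpret product_sigma_finite "\<lambda>i::nat. unit_square_measure" by (rule product_sigma_finite_unit_square)
  have finS: "finite S" using S(1) finite_subset by blast
  have v: "v < n" using S by auto
  define A where "A = {X\<in>space (points_measure n). \<forall>j\<in>S - {v}. torus_dist (X v) (X j) \<le> r}"
  define g where "g = (\<lambda>x y. indicator {y. torus_dist x y \<le> r} y :: ennreal)"
  define f where "f = (\<lambda>X. \<Prod>j\<in>S - {v}. g (X v) (X j))"
  have A: "A \<in> sets (points_measure n)"
  proof -
    have "{X\<in>space (points_measure n). torus_dist (X v) (X j) \<le> r} \<in> sets (points_measure n)" if "j \<in> S" for j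
      using that S by (intro borel_measurable_le sets_points_measure_torus_dist) auto
    then show ?thesis unfolding A_def using finS
      by (intro sets.sets_Collect_finite_All finite_Diff) blast+
  qed
  have fA: "f X = indicator A X" if "X \<in> space (points_measure n)" for X
    using that finS by (auto simp: f_def A_def g_def indicator_def intro!: prod.neutral)
  \<comment> \<open>Singling out the index \<open>v\<close> prepares the iterated integral with the
    point of \<open>v\<close> outermost.\<close>
  have ins: "{..<n} = insert v ({..<n} - {v})" using v by auto
  have fm: "f \<in> borel_measurable (points_measure n)"
    using A by (subst measurable_cong[OF fA]) auto
  have inner: "(\<integral>\<^sup>+X. f (X(v := y)) \<partial>(\<Pi>\<^sub>M i\<in>{..<n}-{v}. unit_square_measure)) \<le> ennreal ((16 * r\<^sup>2) ^ (card S - 1))"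
    if y: "y \<in> {0..1} \<times> {0..1}" for y
  proof -
    have gm: "g y \<in> borel_measurable unit_square_measure"
    proof -
      have "{z. torus_dist y z \<le> r} = {z\<in>space borel. torus_dist y z \<le> r}" by simp
      also have "\<dots> \<in> sets borel" by measurable
      finally show ?thesis unfolding g_def by simp
    qed
    \<comment> \<open>Factors 1 are inserted for indices outside \<open>S\<close>, so that the
      integrand is a product over all remaining coordinates.\<close>
    have "f (X(v := y)) = (\<Prod>j\<in>{..<n}-{v}. if j \<in> S then g y (X j) else 1)" for X
      unfolding f_def by (rule prod.mono_neutral_cong_left) (use S in auto)
    then have "(\<integral>\<^sup>+X. f (X(v := y)) \<partial>(\<Pi>\<^sub>M i\<in>{..<n}-{v}. unit_square_measure)) =
      (\<integral>\<^sup>+X. (\<Prod>j\<in>{..<n}-{v}. (\<lambda>z. if j \<in> S then g y z else 1) (X j)) \<partial>(\<Pi>\<^sub>M i\<in>{..<n}-{v}. unit_square_measure))"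
      by simp
    also have "\<dots> = (\<Prod>j\<in>{..<n}-{v}. \<integral>\<^sup>+z. (if j \<in> S then g y z else 1) \<partial>unit_square_measure)"
      by (rule product_nn_integral_prod) (use gm in auto)
    also have "\<dots> = (\<Prod>j\<in>S-{v}. \<integral>\<^sup>+z. g y z \<partial>unit_square_measure)"
    proof (rule prod.mono_neutral_cong_right)
      show "\<forall>j\<in>{..<n} - {v} - (S - {v}). (\<integral>\<^sup>+z. (if j \<in> S then g y z else 1) \<partial>unit_square_measure) = 1"
      proof
        fix j assume "j \<in> {..<n} - {v} - (S - {v})"
        then have "j \<notin> S" by auto
        then show "(\<integral>\<^sup>+z. (if j \<in> S then g y z else 1) \<partial>unit_square_measure) = 1"
          using U.emeasure_space_1 by simp
      qed
    qed (use S in auto)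
    also have "\<dots> = (\<Prod>j\<in>S-{v}. emeasure unit_square_measure {z. torus_dist y z \<le> r})"
    proof -
      have "{z. torus_dist y z \<le> r} = {z\<in>space borel. torus_dist y z \<le> r}" by simp
      also have "\<dots> \<in> sets borel" by measurable
      finally show ?thesis by (simp add: g_def)
    qed
    also have "\<dots> \<le> (\<Prod>j\<in>S-{v}. ennreal (16 * r\<^sup>2))"
      by (intro prod_mono_ennreal emeasure_torus_ball_le y r)
    also have "\<dots> = ennreal ((16 * r\<^sup>2) ^ (card S - 1))"
      using S finS by (simp add: ennreal_power)
    finally show ?thesis .
  qed
  have "emeasure (points_measure n) A = (\<integral>\<^sup>+X. f X \<partial>points_measure n)"
    using A by (subst nn_integral_cong[OF fA]) auto
  also have "\<dots> = (\<integral>\<^sup>+y. (\<integral>\<^sup>+X. f (X(v := y)) \<partial>(\<Pi>\<^sub>M i\<in>{..<n}-{v}. unit_square_measure)) \<partial>unit_square_measure)"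
    using product_nn_integral_insert_rev[of "{..<n} - {v}" v f, folded ins] fm
    unfolding points_measure_def by simp
  also have "\<dots> \<le> (\<integral>\<^sup>+y. ennreal ((16 * r\<^sup>2) ^ (card S - 1)) \<partial>unit_square_measure)"
    \<comment> \<open>The bound on balls is available only for centres in the unit square, which
      contains almost every point.\<close>
    by (rule nn_integral_mono_AE) (use AE_unit_square_measure inner in auto)
  also have "\<dots> = ennreal ((16 * r\<^sup>2) ^ (card S - 1))"
    using U.emeasure_space_1 by simp
  finally show ?thesis unfolding A_def .
qed

section \<open>The number of points in one cell\<close>

text \<open>Side \<open>r / 2\<close> keeps the diagonal below \<open>r\<close>, so all points in
  the cell are pairwise joined in the geometric graph.\<close>

definition corner_cell :: "real \<Rightarrow> (real \<times> real) set" where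
  "corner_cell r = {0..r / 2} \<times> {0..r / 2}"

lemma torus_dist_corner_cell:
  assumes "x \<in> corner_cell r" "y \<in> corner_cell r" and r1: "r \<le> 1"
  shows "torus_dist x y \<le> r"
proof -
  have r: "r \<ge> 0" using assms by (auto simp: corner_cell_def)
  have "fst x \<in> {0..r / 2}" "snd x \<in> {0..r / 2}" "fst y \<in> {0..r / 2}" "snd y \<in> {0..r / 2}"
    using assms by (auto simp: corner_cell_def mem_Times_iff)
  then have a: "\<bar>fst x - fst y\<bar> \<le> r / 2" "\<bar>snd x - snd y\<bar> \<le> r / 2"
    unfolding atLeastAtMost_iff by linarith+
  \<comment> \<open>\<open>r \<le> 1\<close> keeps the wrapped distance nonnegative, so that
    squaring preserves the upper bound.\<close>
  then have "0 \<le> circle_dist (fst x) (fst y)" "circle_dist (fst x) (fst y) \<le> r / 2"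
    "0 \<le> circle_dist (snd x) (snd y)" "circle_dist (snd x) (snd y) \<le> r / 2"
    using r1 by (auto simp: circle_dist_def)
  then have "(circle_dist (fst x) (fst y))\<^sup>2 \<le> (r / 2)\<^sup>2" "(circle_dist (snd x) (snd y))\<^sup>2 \<le> (r / 2)\<^sup>2"
    by (auto intro: power_mono)
  then have "(circle_dist (fst x) (fst y))\<^sup>2 + (circle_dist (snd x) (snd y))\<^sup>2 \<le> r\<^sup>2"
    using zero_le_power2[of r] unfolding power_divide by (simp del: zero_le_power2, linarith)
  then show ?thesis using r unfolding torus_dist_def by (intro real_le_lsqrt) auto
qed

text \<open>Chernoff bound with exponent -1. The cell has area \<open>a = r^2 / 4\<close> and the
  threshold is \<open>n * a / 4\<close>. Since \<open>exp (- count)\<close> has expectation at most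
  \<open>exp (- n * a / 2)\<close>, Markov's inequality leaves
  \<open>exp (- n * a / 4)\<close>.\<close>

lemma prob_few_points_in_cell:
  assumes r: "0 \<le> r" "r \<le> 1"
  shows "emeasure (points_measure n)
      {X\<in>space (points_measure n). real (card {i\<in>{..<n}. X i \<in> corner_cell r}) \<le> real n * r\<^sup>2 / 16}
    \<le> ennreal (exp (- real n * r\<^sup>2 / 16))"
proof -
  interpret U: prob_space unit_square_measure by (rule prob_space_unit_square_measure)
  interpret product_sigma_finite "\<lambda>i::nat. unit_square_measure" by (rule product_sigma_finite_unit_square)
  define a where "a = r\<^sup>2 / 4"
  have a01: "0 \<le> a" "a \<le> 1" using r power_le_one[of r 2] by (auto simp: a_def)
  have C: "corner_cell r \<in> sets borel" by (simp add: corner_cell_def)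
  have "{0..1} \<times> {0..1} \<inter> corner_cell r = corner_cell r" using r by (auto simp: corner_cell_def)
  then have eC: "emeasure unit_square_measure (corner_cell r) = ennreal a"
    using r C by (simp add: emeasure_unit_square_measure)
      (simp add: corner_cell_def emeasure_lborel_Times ennreal_mult[symmetric] a_def power2_eq_square)
  have pa: "U.prob (corner_cell r) = a" using eC a01 by (simp add: U.emeasure_eq_measure)
  define g where "g = (\<lambda>z. ennreal (exp (- indicator (corner_cell r) z)))"
  define h where "h = (\<lambda>X::nat \<Rightarrow> real \<times> real. \<Prod>i<n. g (X i))"
  have gm [measurable]: "g \<in> borel_measurable unit_square_measure" using C unfolding g_def by measurable
  have comp [measurable]: "(\<lambda>X. X i) \<in> points_measure n \<rightarrow>\<^sub>M unit_square_measure" if "i < n" for i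
    unfolding points_measure_def using that by (auto intro: measurable_component_singleton)
  have hm: "h \<in> borel_measurable (points_measure n)" unfolding h_def
    by (intro borel_measurable_prod_ennreal measurable_compose[OF comp gm]) auto
  have hX: "h X = ennreal (exp (- real (card {i\<in>{..<n}. X i \<in> corner_cell r})))" for X
  proof -
    have "h X = ennreal (\<Prod>i<n. exp (- indicator (corner_cell r) (X i)))"
      unfolding h_def g_def by (subst prod_ennreal) auto
    also have "(\<Prod>i<n. exp (- indicator (corner_cell r) (X i))) = exp (\<Sum>i<n. - indicator (corner_cell r) (X i) :: real)"
      by (simp add: exp_sum)
    also have "(\<Sum>i<n. - indicator (corner_cell r) (X i) :: real) = - real (card {i\<in>{..<n}. X i \<in> corner_cell r})"
      by (simp add: sum_negf indicator_def sum.If_cases Int_def)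
    finally show ?thesis .
  qed
  have gint: "(\<integral>\<^sup>+z. g z \<partial>unit_square_measure) \<le> ennreal (exp (- a / 2))"
  proof -
    have e: "exp (-1::real) \<le> 1 / 2" using exp_ge_add_one_self[of 1] by (simp add: exp_minus field_simps)
    have "(\<integral>\<^sup>+z. g z \<partial>unit_square_measure) = (\<integral>\<^sup>+z. ennreal (exp (-1)) * indicator (corner_cell r) z + 
        indicator (- corner_cell r) z \<partial>unit_square_measure)"
      by (intro nn_integral_cong) (auto simp: g_def indicator_def)
    also have "\<dots> = ennreal (exp (-1)) * ennreal a + emeasure unit_square_measure (- corner_cell r)"
      using C eC by (subst nn_integral_add) (auto simp: nn_integral_cmult)
    also have "emeasure unit_square_measure (- corner_cell r) = ennreal (1 - a)"
      using U.prob_compl[of "corner_cell r"] C pa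
      by (simp add: U.emeasure_eq_measure Compl_eq_Diff_UNIV)
    also have "ennreal (exp (-1)) * ennreal a + ennreal (1 - a) = ennreal (exp (-1) * a + (1 - a))"
      using a01 by (simp add: ennreal_mult)
    also have "\<dots> \<le> ennreal (exp (- a / 2))"
    proof (rule ennreal_leI)
      have "exp (-1) * a \<le> 1 / 2 * a" using e by (intro mult_right_mono) (auto simp: a_def)
      then show "exp (-1) * a + (1 - a) \<le> exp (- a / 2)" using exp_ge_add_one_self[of "- a / 2"] by linarith
    qed
    finally show ?thesis .
  qed
  have Eh: "(\<integral>\<^sup>+X. h X \<partial>points_measure n) \<le> ennreal (exp (- n * a / 2))"
  proof -
    have "(\<integral>\<^sup>+X. h X \<partial>points_measure n) = (\<Prod>i<n. \<integral>\<^sup>+z. g z \<partial>unit_square_measure)"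
      unfolding h_def points_measure_def by (rule product_nn_integral_prod) auto
    also have "\<dots> \<le> (\<Prod>i<n. ennreal (exp (- a / 2)))" by (intro prod_mono_ennreal gint)
    also have "\<dots> = ennreal (exp (- n * a / 2))"
      by (simp add: ennreal_power exp_of_nat_mult[symmetric])
    finally show ?thesis .
  qed
  let ?A = "{X\<in>space (points_measure n). real (card {i\<in>{..<n}. X i \<in> corner_cell r}) \<le> real n * r\<^sup>2 / 16}"
  have "?A = {X\<in>space (points_measure n). 1 \<le> ennreal (exp (n * a / 4)) * h X}"
  proof (intro Collect_cong conj_cong refl)
    fix X
    have "1 \<le> ennreal (exp (n * a / 4)) * h X \<longleftrightarrow> ennreal 1 \<le> ennreal (exp (n * a / 4 - real (card {i\<in>{..<n}. X i \<in> corner_cell r})))"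
      unfolding hX by (simp add: ennreal_mult[symmetric] exp_add[symmetric])
    also have "\<dots> \<longleftrightarrow> real (card {i\<in>{..<n}. X i \<in> corner_cell r}) \<le> n * r\<^sup>2 / 16"
      by (subst ennreal_le_iff) (auto simp: a_def)
    finally show "(real (card {i\<in>{..<n}. X i \<in> corner_cell r}) \<le> real n * r\<^sup>2 / 16) = (1 \<le> ennreal (exp (n * a / 4)) * h X)"
      by simp
  qed
  also have "emeasure (points_measure n) {X\<in>space (points_measure n). 1 \<le> ennreal (exp (n * a / 4)) * h X}
      \<le> ennreal (exp (n * a / 4)) * (\<integral>\<^sup>+X. h X * indicator (space (points_measure n)) X \<partial>points_measure n)"
    by (intro nn_integral_Markov_inequality sets.top borel_measurable_times_ennreal hm borel_measurable_indicator)
  also have "(\<integral>\<^sup>+X. h X * indicator (space (points_measure n)) X \<partial>points_measure n) = (\<integral>\<^sup>+X. h X \<partial>points_measure n)"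
    by (intro nn_integral_cong) auto
  also have "ennreal (exp (n * a / 4)) * (\<integral>\<^sup>+X. h X \<partial>points_measure n) \<le> ennreal (exp (n * a / 4)) * ennreal (exp (- n * a / 2))"
    by (intro mult_left_mono Eh) auto
  also have "\<dots> = ennreal (exp (- real n * r\<^sup>2 / 16))"
    by (simp add: ennreal_mult[symmetric] exp_add[symmetric] a_def field_simps)
  finally show ?thesis .
qed

subsection \<open>The clique number of the random graph\<close>

definition coins_measure :: "nat \<Rightarrow> real \<Rightarrow> (nat set \<Rightarrow> bool) measure" where
  "coins_measure n p = (\<Pi>\<^sub>M e\<in>nsets {..<n} 2. measure_pmf (bernoulli_pmf p))"

lemma Gnrp_space_eq: "Gnrp_space n p = points_measure n \<Otimes>\<^sub>M coins_measure n p"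
  by (simp add: Gnrp_space_def points_measure_def coins_measure_def unit_square_measure_def)

lemma prob_space_coins_measure: "prob_space (coins_measure n p)"
  unfolding coins_measure_def by (intro prob_space_PiM measure_pmf.prob_space_axioms)

lemma finite_nsets_lessThan: "finite (nsets {..<n::nat} 2)"
  by (intro finite_imp_finite_nsets) simp

lemma sets_coin:
  assumes "e \<in> nsets {..<n} 2"
  shows "{B\<in>space (coins_measure n p). B e} \<in> sets (coins_measure n p)"
proof -
  have "(\<lambda>B. B e) \<in> coins_measure n p \<rightarrow>\<^sub>M measure_pmf (bernoulli_pmf p)"
    unfolding coins_measure_def using assms by (rule measurable_component_singleton)
  from measurable_sets[OF this, of "{True}"] show ?thesis
    by (simp add: vimage_def Int_def conj_commute)
qed

lemma measure_coins_measure: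
  assumes "S \<in> sets (coins_measure n p)"
  shows "measure (coins_measure n p) S =
    measure_pmf.prob (Pi_pmf (nsets {..<n} 2) d (\<lambda>_. bernoulli_pmf p)) {B. restrict B (nsets {..<n} 2) \<in> S}"
  using assms unfolding coins_measure_def by (rule measure_PiM_measure_pmf[OF finite_nsets_lessThan])

lemma restrict_in_space_coins: "restrict B (nsets {..<n} 2) \<in> space (coins_measure n p)"
  by (simp add: coins_measure_def space_PiM)

text \<open>Quantifying over the elements of \<open>e\<close> avoids naming its endpoints, so
  measurability of the edge event reduces to finite conjunctions.\<close>

lemma Gnrp_edges_iff:
  assumes "e \<in> nsets {..<n} 2"
  shows "e \<in> Gnrp_edges n r \<omega> \<longleftrightarrow> (\<forall>i\<in>e. \<forall>j\<in>e. i \<noteq> j \<longrightarrow> torus_dist (fst \<omega> i) (fst \<omega> j) \<le> r) \<and> snd \<omega> e"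
proof -
  obtain i j where e: "e = {i, j}" "i < n" "j < n" "i \<noteq> j"
    using assms by (auto elim: nsets2_E)
  have "e \<in> geometric_edges n r (fst \<omega>) \<longleftrightarrow> torus_dist (fst \<omega> i) (fst \<omega> j) \<le> r"
    unfolding geometric_edges_def
    using e torus_dist_commute[of "fst \<omega> i" "fst \<omega> j"] by (auto simp: doubleton_eq_iff)
  then show ?thesis
    using assms e torus_dist_commute[of "fst \<omega> i" "fst \<omega> j"]
    by (auto simp: Gnrp_edges_def binomial_edges_def)
qed

lemma Gnrp_edges_subset: "Gnrp_edges n r \<omega> \<subseteq> nsets {..<n} 2"
  by (auto simp: Gnrp_edges_def binomial_edges_def)

lemma clique_iff_nsets: "clique T E \<longleftrightarrow> (\<forall>e\<in>nsets T 2. e \<in> E)"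
  by (auto simp: clique_def elim!: nsets2_E)

lemma sets_edge:
  assumes e: "e \<in> nsets {..<n} 2"
  shows "{\<omega>\<in>space (Gnrp_space n p). e \<in> Gnrp_edges n r \<omega>} \<in> sets (Gnrp_space n p)"
proof -
  have fe: "finite e" "e \<subseteq> {..<n}" using e by (auto elim!: nsets2_E)
  have 1: "{\<omega>\<in>space (Gnrp_space n p). torus_dist (fst \<omega> i) (fst \<omega> j) \<le> r} \<in> sets (Gnrp_space n p)"
    if "i < n" "j < n" for i j
  proof -
    have "(\<lambda>\<omega>. torus_dist (fst \<omega> i) (fst \<omega> j)) \<in> borel_measurable (Gnrp_space n p)"
      unfolding Gnrp_space_eq
      by (rule measurable_compose[OF measurable_fst sets_points_measure_torus_dist[OF that]])
    then show ?thesis by (intro borel_measurable_le) auto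
  qed
  have 2: "{\<omega>\<in>space (Gnrp_space n p). snd \<omega> e} \<in> sets (Gnrp_space n p)"
  proof -
    have "snd -` {B\<in>space (coins_measure n p). B e} \<inter> space (Gnrp_space n p) \<in> sets (Gnrp_space n p)"
      unfolding Gnrp_space_eq by (rule measurable_sets[OF measurable_snd sets_coin[OF e]])
    also have "snd -` {B\<in>space (coins_measure n p). B e} \<inter> space (Gnrp_space n p) =
        {\<omega>\<in>space (Gnrp_space n p). snd \<omega> e}"
      by (auto simp: Gnrp_space_eq space_pair_measure)
    finally show ?thesis .
  qed
  show ?thesis unfolding Gnrp_edges_iff[OF e]
    using fe 1 2 by (intro sets.sets_Collect_conj sets.sets_Collect_finite_All sets.sets_Collect_imp
      sets.sets_Collect_const) auto
qed

text \<open>The edge set takes only finitely many values, so every event about it is a finite union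
  of events fixing the status of each pair.\<close>

lemma sets_Gnrp_edges:
  "{\<omega>\<in>space (Gnrp_space n p). P (Gnrp_edges n r \<omega>)} \<in> sets (Gnrp_space n p)"
proof -
  let ?E = "nsets {..<n} 2" and ?M = "Gnrp_space n p"
  have eq: "{\<omega>\<in>space ?M. P (Gnrp_edges n r \<omega>)} =
      (\<Union>F\<in>{F\<in>Pow ?E. P F}. {\<omega>\<in>space ?M. \<forall>e\<in>?E. e \<in> Gnrp_edges n r \<omega> \<longleftrightarrow> e \<in> F})"
  proof -
    have "Gnrp_edges n r \<omega> = F" if "F \<subseteq> ?E" "\<forall>e\<in>?E. e \<in> Gnrp_edges n r \<omega> \<longleftrightarrow> e \<in> F" for F \<omega>
      using that Gnrp_edges_subset[of n r \<omega>] by blast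
    then show ?thesis using Gnrp_edges_subset[of n r] by blast
  qed
  have "{\<omega>\<in>space ?M. \<forall>e\<in>?E. e \<in> Gnrp_edges n r \<omega> \<longleftrightarrow> e \<in> F} \<in> sets ?M" for F
  proof (intro sets.sets_Collect_finite_All finite_nsets_lessThan)
    fix e assume e: "e \<in> ?E"
    show "{\<omega>\<in>space ?M. e \<in> Gnrp_edges n r \<omega> \<longleftrightarrow> e \<in> F} \<in> sets ?M"
      using sets_edge[OF e, of p r] sets.sets_Collect_neg[OF sets_edge[OF e, of p r]]
      by (cases "e \<in> F") simp_all
  qed
  then show ?thesis unfolding eq
    by (intro sets.finite_UN) (auto simp: finite_nsets_lessThan)
qed

lemma clique_number_ge:
  assumes "finite V" "S \<subseteq> V" "clique S E"
  shows "card S \<le> clique_number V E"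
  unfolding clique_number_def using assms by (intro Max_ge) auto

lemma clique_of_size_obtain:
  assumes "finite V" "m \<le> clique_number V E"
  obtains S where "S \<subseteq> V" "clique S E" "card S = m"
proof -
  let ?A = "{card S |S. S \<subseteq> V \<and> clique S E}"
  have "{} \<subseteq> V \<and> clique {} E" by simp
  then have "?A \<noteq> {}" by blast
  moreover have "finite ?A" using assms by auto
  ultimately have "clique_number V E \<in> ?A" unfolding clique_number_def by (rule Max_in[rotated])
  then obtain T where T: "T \<subseteq> V" "clique T E" "card T = clique_number V E" by auto
  then obtain S where "S \<subseteq> T" "card S = m"
    using assms(2) obtain_subset_with_card_n[of m T] by metis
  then show ?thesis using that[of S] T smaller_clique by blast
qed

text \<open>Union bound over the \<open>k\<close>-subsets \<open>S\<close>. A clique on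
  \<open>S\<close> forces a geometric star around one of its vertices and success of all coins
  inside \<open>S\<close>; points and coins are independent, so the two probabilities
  multiply.\<close>

lemma prob_clique_number_ge:
  fixes r p :: real and n k :: nat
  assumes r: "r \<ge> 0" and p: "0 \<le> p" "p \<le> 1" and k: "k \<ge> 1"
  shows "measure (Gnrp_space n p) {\<omega>\<in>space (Gnrp_space n p). k \<le> clique_number {..<n} (Gnrp_edges n r \<omega>)}
    \<le> (n choose k) * ((16 * r\<^sup>2) ^ (k - 1) * p ^ (k choose 2))"
proof -
  let ?M = "Gnrp_space n p" and ?E = "nsets {..<n} 2"
  interpret P: prob_space "points_measure n" by (rule prob_space_points_measure)
  interpret Q: prob_space "coins_measure n p" by (rule prob_space_coins_measure)
  interpret M: prob_space "Gnrp_space n p" by (rule prob_space_Gnrp_space)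
  \<comment> \<open>\<open>Min S\<close> serves as a canonical centre of the star;
    \<open>k \<ge> 1\<close> makes \<open>S\<close> nonempty.\<close>
  define A where "A = (\<lambda>S. {X\<in>space (points_measure n). \<forall>j\<in>S - {Min S}. torus_dist (X (Min S)) (X j) \<le> r})"
  define C where "C = (\<lambda>S. {B\<in>space (coins_measure n p). \<forall>e\<in>nsets S 2. B e})"
  have S: "finite S" "Min S \<in> S" "S \<subseteq> {..<n}" "card S = k" if "S \<in> nsets {..<n} k" for S
  proof -
    show fin: "finite S" and "S \<subseteq> {..<n}" and c: "card S = k" using that by (auto simp: nsets_def)
    show "Min S \<in> S" using fin c k by (intro Min_in) auto
  qed
  have A: "A S \<in> sets (points_measure n)" if "S \<in> nsets {..<n} k" for S
  proof -
    have "{X\<in>space (points_measure n). torus_dist (X (Min S)) (X j) \<le> r} \<in> sets (points_measure n)" if "j \<in> S" for j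
      using that S[OF \<open>S \<in> nsets {..<n} k\<close>] by (intro borel_measurable_le sets_points_measure_torus_dist) auto
    then show ?thesis unfolding A_def using S[OF that]
      by (intro sets.sets_Collect_finite_All finite_Diff) blast+
  qed
  have nS: "nsets S 2 \<subseteq> ?E" if "S \<in> nsets {..<n} k" for S
    using S[OF that] by (intro nsets_mono) auto
  have C: "C S \<in> sets (coins_measure n p)" if "S \<in> nsets {..<n} k" for S
    unfolding C_def using nS[OF that] S[OF that]
    by (intro sets.sets_Collect_finite_All sets_coin finite_imp_finite_nsets) auto
  have mC: "emeasure (coins_measure n p) (C S) = ennreal (p ^ (k choose 2))" if "S \<in> nsets {..<n} k" for S
  proof -
    have "{B. restrict B ?E \<in> C S} = {B. \<forall>e\<in>nsets S 2. B e}"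
      using nS[OF that] restrict_in_space_coins by (auto simp: C_def)
    then have "measure (coins_measure n p) (C S) =
        measure_pmf.prob (Pi_pmf ?E undefined (\<lambda>_. bernoulli_pmf p)) {B. \<forall>e\<in>nsets S 2. B e}"
      by (simp add: measure_coins_measure[OF C[OF that], where d = undefined])
    also have "\<dots> = p ^ card (nsets S 2)"
      by (rule prob_Pi_pmf_bernoulli_all) (use nS[OF that] p finite_nsets_lessThan in auto)
    finally show ?thesis using S[OF that] by (simp add: Q.emeasure_eq_measure)
  qed
  have AC: "A S \<times> C S \<in> sets ?M" "measure ?M (A S \<times> C S) \<le> (16 * r\<^sup>2) ^ (k - 1) * p ^ (k choose 2)"
    if "S \<in> nsets {..<n} k" for S
  proof -
    show "A S \<times> C S \<in> sets ?M" using A[OF that] C[OF that] by (simp add: Gnrp_space_eq)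
    have "emeasure ?M (A S \<times> C S) = emeasure (points_measure n) (A S) * emeasure (coins_measure n p) (C S)"
      unfolding Gnrp_space_eq using A[OF that] C[OF that] by (rule Q.emeasure_pair_measure_Times)
    also have "\<dots> \<le> ennreal ((16 * r\<^sup>2) ^ (k - 1)) * ennreal (p ^ (k choose 2))"
      unfolding mC[OF that] A_def using S[OF that] prob_star_le[OF _ _ r, of S n "Min S"]
      by (intro mult_right_mono) auto
    also have "\<dots> = ennreal ((16 * r\<^sup>2) ^ (k - 1) * p ^ (k choose 2))"
      using p by (simp add: ennreal_mult)
    finally show "measure ?M (A S \<times> C S) \<le> (16 * r\<^sup>2) ^ (k - 1) * p ^ (k choose 2)"
      using p by (simp add: M.emeasure_eq_measure)
  qed
  have "{\<omega>\<in>space ?M. k \<le> clique_number {..<n} (Gnrp_edges n r \<omega>)} \<subseteq> (\<Union>S\<in>nsets {..<n} k. A S \<times> C S)"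
  proof
    fix \<omega> assume \<omega>: "\<omega> \<in> {\<omega>\<in>space ?M. k \<le> clique_number {..<n} (Gnrp_edges n r \<omega>)}"
    then obtain T where T: "T \<subseteq> {..<n}" "clique T (Gnrp_edges n r \<omega>)" "card T = k"
      using clique_of_size_obtain[of "{..<n}"] by blast
    then have Tk: "T \<in> nsets {..<n} k" by (auto simp: nsets_def finite_subset)
    note S' = S[OF Tk]
    have e: "e \<in> Gnrp_edges n r \<omega>" if "e \<in> nsets T 2" for e
      using T(2) that by (simp add: clique_iff_nsets)
    have "torus_dist (fst \<omega> (Min T)) (fst \<omega> j) \<le> r" if "j \<in> T - {Min T}" for j
    proof -
      have m: "{Min T, j} \<in> nsets T 2" using that S'(2) by auto
      then have "{Min T, j} \<in> ?E" using nS[OF Tk] by blast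
      from e[OF m, unfolded Gnrp_edges_iff[OF this]] show ?thesis using that by auto
    qed
    moreover have "snd \<omega> e" if "e \<in> nsets T 2" for e
      using e[OF that] nS[OF Tk] that Gnrp_edges_iff by blast
    ultimately have "\<omega> \<in> A T \<times> C T"
      using \<omega> by (auto simp: A_def C_def mem_Times_iff Gnrp_space_eq space_pair_measure)
    then show "\<omega> \<in> (\<Union>S\<in>nsets {..<n} k. A S \<times> C S)" using Tk by blast
  qed
  then have "measure ?M {\<omega>\<in>space ?M. k \<le> clique_number {..<n} (Gnrp_edges n r \<omega>)}
      \<le> measure ?M (\<Union>S\<in>nsets {..<n} k. A S \<times> C S)"
    by (rule M.finite_measure_mono) (use AC in \<open>auto intro!: sets.finite_UN finite_imp_finite_nsets\<close>)
  also have "\<dots> \<le> (\<Sum>S\<in>nsets {..<n} k. measure ?M (A S \<times> C S))"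
    by (rule measure_UNION_le) (use AC in \<open>auto intro!: finite_imp_finite_nsets\<close>)
  also have "\<dots> \<le> (\<Sum>S\<in>nsets {..<n} k. (16 * r\<^sup>2) ^ (k - 1) * p ^ (k choose 2))"
    by (intro sum_mono AC)
  finally show ?thesis by simp
qed

text \<open>Conditioning on the points: unless the corner cell has at most
  \<open>n * r^2 / 16\<close> of them, it contains \<open>k * s\<close> vertices, which are cut into
  \<open>k\<close> blocks of size \<open>s\<close>. These vertices are pairwise within distance
  \<open>r\<close>, so only the coins matter and \<open>large_clique_lower_tail\<close>
  applies.\<close>

lemma prob_clique_number_less:
  fixes r p t :: real and n k s :: nat
  assumes r: "0 \<le> r" "r \<le> 1" and p: "0 < p" "p \<le> 1" and k: "k > 0" and s: "s > 0" and t: "t > 0"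
    and ks: "real k * real s \<le> real n * r\<^sup>2 / 16"
  shows "measure (Gnrp_space n p) {\<omega>\<in>space (Gnrp_space n p). real (clique_number {..<n} (Gnrp_edges n r \<omega>)) < k - t}
    \<le> exp (- real n * r\<^sup>2 / 16) + exp (k * sqrt (1 / p) ^ k / s - t\<^sup>2 / k)"
proof -
  let ?M = "Gnrp_space n p" and ?E = "nsets {..<n} 2"
  let ?P = "points_measure n" and ?Q = "coins_measure n p"
  interpret P: prob_space "points_measure n" by (rule prob_space_points_measure)
  interpret Q: prob_space "coins_measure n p" by (rule prob_space_coins_measure)
  interpret M: prob_space "Gnrp_space n p" by (rule prob_space_Gnrp_space)
  define c where "c = exp (k * sqrt (1 / p) ^ k / s - t\<^sup>2 / k)"
  define Bad where "Bad = {\<omega>\<in>space ?M. real (clique_number {..<n} (Gnrp_edges n r \<omega>)) < k - t}"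
  define I where "I = (\<lambda>X. {i\<in>{..<n}. X i \<in> corner_cell r})"
  define Few where "Few = {X\<in>space ?P. real (card (I X)) \<le> real n * r\<^sup>2 / 16}"
  have BadM: "Bad \<in> sets (?P \<Otimes>\<^sub>M ?Q)"
    unfolding Bad_def Gnrp_space_eq[symmetric] by (rule sets_Gnrp_edges)
  have FewM: "Few \<in> sets ?P"
  proof -
    have "(\<lambda>X. X i) \<in> ?P \<rightarrow>\<^sub>M borel" if "i < n" for i
    proof -
      have "(\<lambda>X. X i) \<in> ?P \<rightarrow>\<^sub>M unit_square_measure"
        unfolding points_measure_def using that by (auto intro: measurable_component_singleton)
      then show ?thesis by (simp cong: measurable_cong_sets)
    qed
    then have "(\<lambda>X. \<Sum>i<n. indicator (corner_cell r) (X i) :: real) \<in> borel_measurable ?P"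
      by (intro borel_measurable_sum measurable_compose[of _ ?P borel "indicator (corner_cell r)"])
         (auto simp: corner_cell_def)
    moreover have "(\<Sum>i<n. indicator (corner_cell r) (X i) :: real) = real (card (I X))" for X
      by (simp add: I_def indicator_def sum.If_cases Int_def)
    ultimately have "(\<lambda>X. real (card (I X))) \<in> borel_measurable ?P" by simp
    then show ?thesis unfolding Few_def by (intro borel_measurable_le) auto
  qed
  have sec_le: "emeasure ?Q (Pair X -` Bad) \<le> ennreal c" if X: "X \<in> space ?P" "X \<notin> Few" for X
  proof -
    have "real k * real s \<le> card (I X)" using X ks by (auto simp: Few_def)
    then have "k * s \<le> card (I X)" by (metis of_nat_le_iff of_nat_mult)
    then obtain U where U: "U \<subseteq> I X" "card U = k * s" "finite U"
      by (rule obtain_subset_with_card_n)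
    \<comment> \<open>The first coordinate of such a bijection is the block index.\<close>
    have "\<exists>h. bij_betw h U ({..<k} \<times> {..<s})"
      by (rule finite_same_card_bij) (use U in auto)
    then obtain h where h: "bij_betw h U ({..<k} \<times> {..<s})" by blast
    \<comment> \<open>The default 0 gives vertices outside \<open>U\<close> a legal index, as
      \<open>k > 0\<close>; block sizes are counted within \<open>U\<close> only.\<close>
    define b where "b = (\<lambda>v. if v \<in> U then fst (h v) else 0)"
    have UV: "U \<subseteq> {..<n}" using U by (auto simp: I_def)
    have bk: "b v < k" for v using bij_betwE[OF h] k by (force simp: b_def)
    have bs: "card {v\<in>U. b v = i} = s" if i: "i < k" for i
    proof -
      have "bij_betw h {v\<in>U. b v = i} ({i} \<times> {..<s})"
      proof (rule bij_betw_subset[OF h])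
        show "h ` {v\<in>U. b v = i} = {i} \<times> {..<s}"
        proof
          show "h ` {v\<in>U. b v = i} \<subseteq> {i} \<times> {..<s}"
          proof
            fix y assume "y \<in> h ` {v\<in>U. b v = i}"
            then obtain v where v: "v \<in> U" "b v = i" "y = h v" by blast
            have "h v \<in> {..<k} \<times> {..<s}" using bij_betwE[OF h] v(1) by blast
            then show "y \<in> {i} \<times> {..<s}" using v by (simp add: mem_Times_iff b_def)
          qed
          show "{i} \<times> {..<s} \<subseteq> h ` {v\<in>U. b v = i}"
          proof
            fix y assume y: "y \<in> {i} \<times> {..<s}"
            then have "y \<in> h ` U" using i h by (auto simp: bij_betw_def)
            then obtain v where "v \<in> U" "y = h v" by blast
            then show "y \<in> h ` {v\<in>U. b v = i}" using y by (auto simp: b_def)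
          qed
        qed
      qed auto
      then show ?thesis by (simp add: bij_betw_same_card card_cartesian_product)
    qed
    have secM: "Pair X -` Bad \<in> sets ?Q" using BadM by (rule sets_Pair1)
    have "measure ?Q (Pair X -` Bad) =
        measure_pmf.prob (Pi_pmf ?E undefined (\<lambda>_. bernoulli_pmf p)) {B. restrict B ?E \<in> Pair X -` Bad}"
      by (rule measure_coins_measure[OF secM])
    also have "\<dots> \<le> measure_pmf.prob (Pi_pmf ?E undefined (\<lambda>_. bernoulli_pmf p))
        {B. \<not> (\<exists>T\<subseteq>U. k - t \<le> card T \<and> (\<forall>e\<in>nsets T 2. B e))}"
    proof (rule measure_pmf.finite_measure_mono)
      show "{B. restrict B ?E \<in> Pair X -` Bad} \<subseteq> {B. \<not> (\<exists>T\<subseteq>U. k - t \<le> card T \<and> (\<forall>e\<in>nsets T 2. B e))}"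
      proof (rule subsetI, rule CollectI, rule notI)
        fix B assume "B \<in> {B. restrict B ?E \<in> Pair X -` Bad}"
          and "\<exists>T\<subseteq>U. k - t \<le> card T \<and> (\<forall>e\<in>nsets T 2. B e)"
        then obtain T where B: "restrict B ?E \<in> Pair X -` Bad"
          and T: "T \<subseteq> U" "k - t \<le> card T" "\<forall>e\<in>nsets T 2. B e" by blast
        have TV: "nsets T 2 \<subseteq> ?E" using T(1) UV by (intro nsets_mono) auto
        have "clique T (Gnrp_edges n r (X, restrict B ?E))"
          unfolding clique_iff_nsets
        proof
          fix e assume e: "e \<in> nsets T 2"
          have "torus_dist (X i) (X j) \<le> r" if "i \<in> e" "j \<in> e" for i j
          proof (rule torus_dist_corner_cell)
            have "e \<subseteq> I X" using e T(1) U(1) by (auto simp: nsets_def)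
            then show "X i \<in> corner_cell r" "X j \<in> corner_cell r" using that by (auto simp: I_def)
          qed fact
          then show "e \<in> Gnrp_edges n r (X, restrict B ?E)"
            using e T(3) TV by (subst Gnrp_edges_iff) auto
        qed
        then have "card T \<le> clique_number {..<n} (Gnrp_edges n r (X, restrict B ?E))"
          using T(1) UV by (intro clique_number_ge) auto
        then show False using B T(2) by (simp add: Bad_def)
      qed
    qed simp
    also have "\<dots> \<le> c" unfolding c_def
      by (rule large_clique_lower_tail[OF _ UV bk bs s p k t]) auto
    finally show ?thesis by (simp add: Q.emeasure_eq_measure c_def)
  qed
  have "emeasure ?M Bad = (\<integral>\<^sup>+X. emeasure ?Q (Pair X -` Bad) \<partial>?P)"
    unfolding Gnrp_space_eq using BadM by (rule Q.emeasure_pair_measure_alt)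
  \<comment> \<open>The conditional failure probability is at most 1 when the cell has few points
    and at most \<open>c\<close> otherwise.\<close>
  also have "\<dots> \<le> (\<integral>\<^sup>+X. indicator Few X + ennreal c \<partial>?P)"
  proof (rule nn_integral_mono)
    fix X assume X: "X \<in> space ?P"
    show "emeasure ?Q (Pair X -` Bad) \<le> indicator Few X + ennreal c"
    proof (cases "X \<in> Few")
      case True
      have "emeasure ?Q (Pair X -` Bad) \<le> 1" by (rule Q.emeasure_le_1)
      also have "1 \<le> indicator Few X + ennreal c" using True by simp
      finally show ?thesis .
    next
      case False
      then show ?thesis using sec_le[OF X] by simp
    qed
  qed
  also have "\<dots> = emeasure ?P Few + ennreal c"
    using FewM P.emeasure_space_1 by (simp add: nn_integral_add)
  also have "\<dots> \<le> ennreal (exp (- real n * r\<^sup>2 / 16)) + ennreal c"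
    using prob_few_points_in_cell[OF r, of n] unfolding Few_def I_def by (intro add_right_mono)
  also have "\<dots> = ennreal (exp (- real n * r\<^sup>2 / 16) + c)"
    by (simp add: c_def)
  finally have "ennreal (measure ?M Bad) \<le> ennreal (exp (- real n * r\<^sup>2 / 16) + c)"
    by (simp only: M.emeasure_eq_measure)
  moreover have "0 \<le> exp (- real n * r\<^sup>2 / 16) + c" by (simp add: c_def add_nonneg_nonneg)
  ultimately show ?thesis
    unfolding Bad_def[symmetric] c_def[symmetric] by (simp only: ennreal_le_iff)
qed

subsection \<open>Choice of the parameters\<close>

text \<open>\<open>k^k / k!\<close> is a single term of the series of \<open>exp k\<close>.\<close>

lemma power_le_exp_mult_fact: "real k ^ k \<le> exp (real k) * fact k"
proof -
  have "(\<Sum>i\<in>{k}. inverse (fact i) *\<^sub>R real k ^ i) \<le> exp (real k)"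
    unfolding exp_def by (rule sum_le_suminf[OF summable_exp_generic]) auto
  then show ?thesis by (simp add: field_simps)
qed

text \<open>Up to one spare factor \<open>exp 1 * n / k \<le> 3 * n\<close>, the expectation is a
  \<open>(k - 1)\<close>-st power. Its base is at most \<open>16 * exp 1 / (q * k)\<close>, because
  \<open>q * k / 2 \<ge> L\<close> gives
  \<open>exp (- (q * k / 2)) \<le> 1 / (q * n * r^2)\<close>.\<close>

lemma clique_first_moment_le:
  fixes q L r :: real and n k :: nat
  assumes q: "0 < q" "q \<le> 1" and N: "real n * r\<^sup>2 > 0" and L: "L = ln (q * (real n * r\<^sup>2))" "L \<ge> 72"
    and k: "real k \<ge> 2 * L / q" "k > 0"
  shows "(n choose k) * ((16 * r\<^sup>2) ^ (k - 1) * (1 - q) ^ (k choose 2)) \<le> 3 * real n * exp (- (real k - 1))"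
proof -
  have e3: "exp (1::real) \<le> 3" by (rule exp_le)
  have kpos: "real k > 0" using k by simp
  have n1: "n > 0" and r0: "r \<noteq> 0" using N by (auto intro: gr0I)
  have "(n choose k) * real k ^ k \<le> (n choose k) * (exp k * fact k)"
    by (intro mult_left_mono power_le_exp_mult_fact) auto
  also have "\<dots> = exp k * real ((n choose k) * fact k)" by simp
  also have "\<dots> \<le> exp k * real (n ^ k)"
    by (intro mult_left_mono, unfold of_nat_le_iff, rule binomial_fact_pow) auto
  finally have "real (n choose k) \<le> exp k * real n ^ k / real k ^ k"
    using kpos by (simp add: field_simps)
  also have "\<dots> = (exp 1 * n / k) ^ k"
    by (simp add: power_divide power_mult_distrib exp_of_nat_mult[symmetric])
  \<comment> \<open>One factor is split off to match the exponent \<open>k - 1\<close> of the star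
    probability.\<close>
  also have "\<dots> = (exp 1 * n / k) * (exp 1 * n / k) ^ (k - 1)"
    using k by (simp add: power_eq_if)
  also have "\<dots> \<le> (3 * real n) * (exp 1 * n / k) ^ (k - 1)"
  proof (intro mult_right_mono)
    have "exp 1 * n / k \<le> exp 1 * n / 1" using k by (intro divide_left_mono) auto
    also have "\<dots> \<le> 3 * real n" using mult_right_mono[OF e3, of "real n"] by simp
    finally show "exp 1 * n / k \<le> 3 * real n" .
  qed simp
  finally have ch: "real (n choose k) \<le> (3 * real n) * (exp 1 * n / k) ^ (k - 1)" .
  have "(1 - q) ^ (k choose 2) \<le> exp (- q) ^ (k choose 2)"
    using exp_ge_add_one_self[of "- q"] q by (intro power_mono) auto
  also have "\<dots> = exp (- (q * real k / 2)) ^ (k - 1)"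
  proof -
    have "2 * (k choose 2) = k * (k - 1)" using choose_two[of k] by (cases "even k") auto
    then have "2 * real (k choose 2) = real k * real (k - 1)"
      by (simp only: of_nat_mult[symmetric] of_nat_numeral[symmetric, where 'a = real])
    then have "- q * real (k choose 2) = - (q * real k / 2) * real (k - 1)" by (simp add: mult_ac)
    then show ?thesis by (simp only: exp_of_nat2_mult[symmetric])
  qed
  also have "\<dots> \<le> (1 / (q * (real n * r\<^sup>2))) ^ (k - 1)"
  proof (intro power_mono)
    have "L \<le> q * real k / 2" using k q by (simp add: field_simps)
    then have "exp (- (q * real k / 2)) \<le> exp (- L)" by simp
    also have "\<dots> = 1 / (q * (real n * r\<^sup>2))" using q N by (simp add: L(1) exp_minus inverse_eq_divide)
    finally show "exp (- (q * real k / 2)) \<le> 1 / (q * (real n * r\<^sup>2))" .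
  qed simp
  finally have pw: "(1 - q) ^ (k choose 2) \<le> (1 / (q * (real n * r\<^sup>2))) ^ (k - 1)" .
  have base: "(exp 1 * n / k) * (16 * r\<^sup>2) * (1 / (q * (real n * r\<^sup>2))) \<le> exp (- 1)"
  proof -
    have "(exp 1 * n / k) * (16 * r\<^sup>2) * (1 / (q * (real n * r\<^sup>2))) = 16 * exp 1 / (q * k)"
      using n1 r0 by (simp add: field_simps)
    \<comment> \<open>This fixes the threshold 72:
      \<open>16 * exp 1 * exp 1 \<le> 16 * 9 = 2 * 72\<close>.\<close>
    also have "\<dots> \<le> 16 * exp 1 / (2 * 72)"
    proof (intro divide_left_mono)
      have "2 * L \<le> q * k" using k q by (simp add: field_simps)
      then show "2 * 72 \<le> q * real k" using L(2) by simp
    qed (use q kpos in auto)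
    also have "\<dots> \<le> 1 / exp 1"
    proof -
      have "exp 1 * exp 1 \<le> 3 * (3::real)" by (intro mult_mono e3) auto
      then show ?thesis by (simp add: field_simps)
    qed
    finally show ?thesis by (simp add: exp_minus inverse_eq_divide)
  qed
  have "(n choose k) * ((16 * r\<^sup>2) ^ (k - 1) * (1 - q) ^ (k choose 2)) \<le>
    ((3 * real n) * (exp 1 * n / k) ^ (k - 1)) * ((16 * r\<^sup>2) ^ (k - 1) * (1 / (q * (real n * r\<^sup>2))) ^ (k - 1))"
    using q by (intro mult_mono ch pw) auto
  also have "\<dots> = 3 * real n * ((exp 1 * n / k) * (16 * r\<^sup>2) * (1 / (q * (real n * r\<^sup>2)))) ^ (k - 1)"
    by (simp only: power_mult_distrib mult_ac)
  also have "\<dots> \<le> 3 * real n * exp (- 1) ^ (k - 1)"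
    using q N by (intro mult_left_mono power_mono base) auto
  also have "exp (- 1 :: real) ^ (k - 1) = exp (- (real k - 1))"
    using k by (simp add: exp_of_nat_mult[symmetric] of_nat_diff)
  finally show ?thesis .
qed

text \<open>With \<open>k\<close> close to \<open>(2 - \<epsilon> / 2) * L / q\<close>, the weight
  \<open>(1 - q)\<close> to the power \<open>- k / 2\<close> is about
  \<open>exp ((1 - \<epsilon> / 4) * L)\<close>, while \<open>s\<close> is at least
  \<open>exp L / (96 * L)\<close>. The quotient is of order
  \<open>L * exp (- (\<epsilon> * L / 8))\<close> at most.\<close>

lemma transversal_parameters:
  fixes q L N \<epsilon> :: real and k :: nat
  assumes q: "0 < q" "q \<le> \<epsilon> / 16" and \<epsilon>: "0 < \<epsilon>" "\<epsilon> \<le> 1"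
    and N: "N > 0" and L: "L = ln (q * N)" "L \<ge> 1" "96 * L \<le> exp L"
      "288 * L * exp (- (\<epsilon> * L / 8)) \<le> \<epsilon>\<^sup>2 / 32"
    and k: "real k \<ge> (2 - \<epsilon> / 2) * L / q" "real k \<le> (2 - \<epsilon> / 2) * L / q + 1"
    and s: "s = nat \<lfloor>N / (16 * real k)\<rfloor>"
  shows "s > 0" and "real k * real s \<le> N / 16"
    and "sqrt (1 / (1 - q)) ^ k / s \<le> \<epsilon>\<^sup>2 / 32"
proof -
  have q1: "q \<le> 1 / 16" using q \<epsilon> by linarith
  have kq: "L / q \<le> k"
  proof -
    have "L / q \<le> (2 - \<epsilon> / 2) * L / q"
    proof (rule divide_right_mono)
      have "1 * L \<le> (2 - \<epsilon> / 2) * L" using \<epsilon> L by (intro mult_right_mono) auto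
      then show "L \<le> (2 - \<epsilon> / 2) * L" by simp
    qed (use q in simp)
    then show ?thesis using k by linarith
  qed
  have Lq: "1 \<le> L / q" using q q1 L by (simp add: field_simps)
  have kpos: "real k > 0" using kq Lq by linarith
  \<comment> \<open>The rounding term 1 in the bound on \<open>k\<close> is absorbed by
    \<open>1 \<le> L / q\<close>.\<close>
  have k3: "real k \<le> 3 * (L / q)"
  proof -
    have "(2 - \<epsilon> / 2) * (L / q) \<le> 2 * (L / q)" using \<epsilon> Lq by (intro mult_right_mono) auto
    then show ?thesis using k(2) Lq by simp
  qed
  have eL: "exp L = q * N" using q N by (simp add: L(1))
  define y where "y = N / (16 * real k)"
  have "exp L / (48 * L) = N / (16 * (3 * (L / q)))" using q by (simp add: eL field_simps)
  also have "\<dots> \<le> y" unfolding y_def using N k3 kpos Lq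
    by (intro divide_left_mono mult_pos_pos) auto
  finally have y: "exp L / (48 * L) \<le> y" .
  \<comment> \<open>With \<open>y \<ge> 2\<close>, rounding \<open>y\<close> down to
    \<open>s\<close> loses at most half, turning 48 into 96.\<close>
  have "2 \<le> exp L / (48 * L)" using L by (simp add: field_simps)
  then have y2: "y \<ge> 2" using y by linarith
  have s': "real s > y - 1" "real s \<le> y" using y2 unfolding s y_def[symmetric] by linarith+
  show s0: "s > 0" using s' y2 by linarith
  have "real k * real s \<le> real k * y" using s' by (intro mult_left_mono) auto
  also have "\<dots> = N / 16" using kpos by (simp add: y_def)
  finally show "real k * real s \<le> N / 16" .
  have "y / 2 \<le> real s" using s' y2 by linarith
  then have sL: "exp L / (96 * L) \<le> real s" using y by (simp add: field_simps)
  have "sqrt (1 / (1 - q)) \<le> exp ((q + 2 * q\<^sup>2) / 2)"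
  proof -
    have "- q - 2 * q\<^sup>2 \<le> ln (1 - q)"
      using ln_one_minus_pos_lower_bound[of q] q q1 by simp
    then have "exp (- q - 2 * q\<^sup>2) \<le> 1 - q" using q q1 by (subst ln_ge_iff[symmetric]) auto
    then have "1 / (1 - q) \<le> 1 / exp (- q - 2 * q\<^sup>2)" by (intro divide_left_mono) (use q1 in auto)
    also have "\<dots> = (exp ((q + 2 * q\<^sup>2) / 2))\<^sup>2"
      by (simp add: exp_double[symmetric] power2_eq_square exp_add[symmetric] exp_minus[symmetric] inverse_eq_divide[symmetric])
    finally show ?thesis by (intro real_le_lsqrt) auto
  qed
  then have "sqrt (1 / (1 - q)) ^ k \<le> exp ((q + 2 * q\<^sup>2) / 2) ^ k"
    using q1 by (intro power_mono) auto
  also have "\<dots> = exp (real k * ((q + 2 * q\<^sup>2) / 2))" by (simp only: exp_of_nat_mult)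
  \<comment> \<open>From \<open>q \<le> \<epsilon> / 16\<close> the second-order factor
    \<open>1 + 2 * q\<close> is at most \<open>1 + \<epsilon> / 8\<close>, which uses up half of the
    saving \<open>\<epsilon> / 4\<close>. The summand 1 pays for rounding \<open>k\<close>
    up.\<close>
  also have "\<dots> \<le> exp (1 + (L - \<epsilon> * L / 8))"
  proof -
    have "real k * ((q + 2 * q\<^sup>2) / 2) \<le> ((2 - \<epsilon> / 2) * L / q + 1) * ((q + 2 * q\<^sup>2) / 2)"
      using q k by (intro mult_right_mono) auto
    also have "\<dots> = (1 - \<epsilon> / 4) * L * (1 + 2 * q) + q * (1 + 2 * q) / 2"
      using q by (simp add: field_simps power2_eq_square)
    also have "\<dots> \<le> (1 - \<epsilon> / 4) * L * (1 + \<epsilon> / 8) + 1"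
    proof (intro add_mono mult_left_mono)
      show "0 \<le> (1 - \<epsilon> / 4) * L" using \<epsilon> L by simp
      have "q * (1 + 2 * q) \<le> 1 * 2" using q q1 by (intro mult_mono) auto
      then show "q * (1 + 2 * q) / 2 \<le> 1" by simp
    qed (use q in auto)
    also have "(1 - \<epsilon> / 4) * L * (1 + \<epsilon> / 8) \<le> L - \<epsilon> * L / 8"
    proof -
      have "(1 - \<epsilon> / 4) * L * (1 + \<epsilon> / 8) = L - \<epsilon> * L / 8 - \<epsilon>\<^sup>2 * L / 32"
        by (simp add: field_simps power2_eq_square)
      moreover have "\<epsilon>\<^sup>2 * L / 32 \<ge> 0" using L by simp
      ultimately show ?thesis by linarith
    qed
    finally show ?thesis by simp
  qed
  also have "\<dots> = exp 1 * exp L * exp (- (\<epsilon> * L / 8))"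
    by (simp add: exp_add[symmetric])
  also have "\<dots> \<le> 3 * exp L * exp (- (\<epsilon> * L / 8))"
    by (intro mult_right_mono exp_le) auto
  finally have w: "sqrt (1 / (1 - q)) ^ k \<le> 3 * exp L * exp (- (\<epsilon> * L / 8))" .
  have "sqrt (1 / (1 - q)) ^ k / s \<le> (3 * exp L * exp (- (\<epsilon> * L / 8))) / (exp L / (96 * L))"
    using w sL L q1 by (intro frac_le) auto
  also have "\<dots> = 288 * L * exp (- (\<epsilon> * L / 8))" using L by (simp add: field_simps)
  finally show "sqrt (1 / (1 - q)) ^ k / s \<le> \<epsilon>\<^sup>2 / 32" using L by linarith
qed

text \<open>Provides the threshold on \<open>L\<close> that determines the constant
  \<open>C\<close>; 72 is inherited from the first moment bound.\<close>

lemma large_L_conditions: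
  fixes \<epsilon> :: real assumes "\<epsilon> > 0"
  shows "\<exists>L0\<ge>72. \<forall>L\<ge>L0. 96 * L \<le> exp L \<and> 288 * L * exp (- (\<epsilon> * L / 8)) \<le> \<epsilon>\<^sup>2 / 32"
proof -
  have "((\<lambda>L::real. 288 * L * exp (- (\<epsilon> * L / 8))) \<longlongrightarrow> 0) at_top"
    using assms by real_asymp
  then have "\<forall>\<^sub>F L in at_top. 288 * L * exp (- (\<epsilon> * L / 8)) < \<epsilon>\<^sup>2 / 32"
    using assms by (intro order_tendstoD) auto
  moreover have "\<forall>\<^sub>F L::real in at_top. 96 * L \<le> exp L" by real_asymp
  ultimately have "\<forall>\<^sub>F L::real in at_top. 96 * L \<le> exp L \<and> 288 * L * exp (- (\<epsilon> * L / 8)) \<le> \<epsilon>\<^sup>2 / 32"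
    by eventually_elim auto
  then obtain L1 where L1: "\<forall>L\<ge>L1. 96 * L \<le> exp L \<and> 288 * L * exp (- (\<epsilon> * L / 8)) \<le> \<epsilon>\<^sup>2 / 32"
    unfolding eventually_at_top_linorder by blast
  then show ?thesis by (intro exI[of _ "max 72 L1"]) auto
qed

text \<open>The factor \<open>n\<close> left over from the union bound is beaten by
  \<open>exp (- (ln n ^ 3))\<close>; this exponent comes from the assumed bound on
  \<open>1 - p\<close>.\<close>

lemma failure_tendsto_0:
  fixes \<epsilon> :: real assumes "\<epsilon> > 0"
  shows "(\<lambda>n::nat. 3 * real n * exp (- (ln n ^ 3)) + (exp (- ln n / 16) + exp (- (\<epsilon>\<^sup>2 / 32 * ln n ^ 3)))) \<longlonglongrightarrow> 0"
proof -
  have "0 < \<epsilon>\<^sup>2 / 32" using assms by simp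
  then obtain c where c: "c = \<epsilon>\<^sup>2 / 32" "c > 0" by blast
  have "(\<lambda>n::nat. 3 * real n * exp (- (ln n ^ 3)) + (exp (- ln n / 16) + exp (- (c * ln n ^ 3)))) \<longlonglongrightarrow> 0"
    using c(2) by real_asymp
  then show ?thesis unfolding c(1) .
qed

section \<open>Combining the two tails and passing to the limit\<close>

lemma prob_clique_number_bounds:
  fixes \<epsilon> r p L :: real and n :: nat
  defines "q \<equiv> 1 - p"
  assumes \<epsilon>: "0 < \<epsilon>" "\<epsilon> \<le> 1" and r: "0 \<le> r" "r \<le> 1" and q: "0 < q" "q \<le> \<epsilon> / 16"
    and n: "ln n > 0" "real n * r\<^sup>2 \<ge> ln n" "q \<le> 1 / ln n ^ 3"
    and L: "L = ln (q * (real n * r\<^sup>2))" "L \<ge> 72" "96 * L \<le> exp L"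
      "288 * L * exp (- (\<epsilon> * L / 8)) \<le> \<epsilon>\<^sup>2 / 32"
  shows "measure (Gnrp_space n p) {\<omega>\<in>space (Gnrp_space n p).
      (2 - \<epsilon>) * L / q \<le> real (clique_number {..<n} (Gnrp_edges n r \<omega>)) \<and>
      real (clique_number {..<n} (Gnrp_edges n r \<omega>)) \<le> 2 * L / q}
    \<ge> 1 - (3 * n * exp (- (ln n ^ 3)) + (exp (- ln n / 16) + exp (- (\<epsilon>\<^sup>2 / 32 * ln n ^ 3))))"
proof -
  let ?M = "Gnrp_space n p" and ?c = "\<lambda>\<omega>. real (clique_number {..<n} (Gnrp_edges n r \<omega>))"
  interpret M: prob_space "Gnrp_space n p" by (rule prob_space_Gnrp_space)
  have q1: "q \<le> 1 / 16" using q \<epsilon> by linarith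
  have p: "0 < p" "p \<le> 1" "p = 1 - q" using q q1 by (auto simp: q_def)
  have N: "real n * r\<^sup>2 > 0" using n by linarith
  \<comment> \<open>With \<open>1 / q \<le> L / q\<close>, this makes both clique sizes below at
    least of order \<open>ln n ^ 3\<close>, which drives the failure probabilities to 0.\<close>
  have ln3: "ln n ^ 3 \<le> 1 / q" using n q by (simp add: field_simps)
  have Lq: "1 / q \<le> L / q" using L q by (intro divide_right_mono) auto
  have q_inv: "1 \<le> 1 / q" using q q1 by (simp add: field_simps)

  \<comment> \<open>The least integer exceeding \<open>2 * L / q\<close>.\<close>
  define k where "k = Suc (nat \<lfloor>2 * L / q\<rfloor>)"
  have k: "real k \<ge> 2 * L / q" "real k - 1 \<ge> 2 * L / q - 1" "k \<ge> 1" unfolding k_def by linarith+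
  have up_iff: "k \<le> clique_number {..<n} (Gnrp_edges n r \<omega>)" if "\<not> ?c \<omega> \<le> 2 * L / q" for \<omega>
  proof -
    have "0 \<le> \<lfloor>2 * L / q\<rfloor>" using L q by simp
    moreover have "\<lfloor>2 * L / q\<rfloor> < int (clique_number {..<n} (Gnrp_edges n r \<omega>))"
      using that by (simp add: floor_less_iff)
    ultimately show ?thesis unfolding k_def by linarith
  qed
  have "measure ?M {\<omega>\<in>space ?M. k \<le> clique_number {..<n} (Gnrp_edges n r \<omega>)}
      \<le> (n choose k) * ((16 * r\<^sup>2) ^ (k - 1) * (1 - q) ^ (k choose 2))"
    unfolding p(3)[symmetric] by (rule prob_clique_number_ge) (use r p k in auto)
  also have "\<dots> \<le> 3 * n * exp (- (real k - 1))"
    using clique_first_moment_le[OF q(1) _ N L(1,2) k(1)] q1 k by simp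
  also have "\<dots> \<le> 3 * n * exp (- (ln n ^ 3))"
  proof -
    have "ln n ^ 3 \<le> real k - 1" using k(2) ln3 Lq q_inv L(2) by simp
    then show ?thesis by (intro mult_left_mono) auto
  qed
  finally have up: "measure ?M {\<omega>\<in>space ?M. k \<le> clique_number {..<n} (Gnrp_edges n r \<omega>)} \<le> 3 * n * exp (- (ln n ^ 3))" .

  define \<kappa> where "\<kappa> = nat \<lceil>(2 - \<epsilon> / 2) * L / q\<rceil>"
  define s where "s = nat \<lfloor>real n * r\<^sup>2 / (16 * real \<kappa>)\<rfloor>"
  \<comment> \<open>The loss \<open>t\<close> is affordable since \<open>(1 - \<epsilon> / 4) * (2 -
    \<epsilon> / 2) \<ge> 2 - \<epsilon>\<close>, and it suffices since
    \<open>t^2 / \<kappa> = \<kappa> * \<epsilon>^2 / 16\<close> is twice the second moment cost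
    \<open>\<kappa> * \<epsilon>^2 / 32\<close>.\<close>
  define t where "t = \<epsilon> * \<kappa> / 4"
  have "0 < (2 - \<epsilon> / 2) * L / q" using \<epsilon> L q by (intro divide_pos_pos mult_pos_pos) auto
  then have \<kappa>: "real \<kappa> \<ge> (2 - \<epsilon> / 2) * L / q" "real \<kappa> \<le> (2 - \<epsilon> / 2) * L / q + 1"
    unfolding \<kappa>_def by linarith+
  have "1 * (L / q) \<le> (2 - \<epsilon> / 2) * (L / q)"
    using \<epsilon> Lq q_inv by (intro mult_right_mono) auto
  then have \<kappa>L: "L / q \<le> \<kappa>" using \<kappa>(1) by simp
  then have \<kappa>3: "ln n ^ 3 \<le> \<kappa>" and \<kappa>0: "real \<kappa> > 0" using ln3 Lq q_inv by linarith+
  have L1: "L \<ge> 1" using L by simp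
  note tp = transversal_parameters[OF q \<epsilon> N L(1) L1 L(3,4) \<kappa> s_def]
  have t: "t > 0" using \<epsilon> \<kappa>0 by (simp add: t_def)
  have low_iff: "?c \<omega> < \<kappa> - t" if "\<not> (2 - \<epsilon>) * L / q \<le> ?c \<omega>" for \<omega>
  proof -
    have "(2 - \<epsilon>) * (L / q) \<le> (1 - \<epsilon> / 4) * ((2 - \<epsilon> / 2) * (L / q))"
    proof -
      have "(2 - \<epsilon>) \<le> (1 - \<epsilon> / 4) * (2 - \<epsilon> / 2)" by (simp add: field_simps)
      then have "(2 - \<epsilon>) * (L / q) \<le> ((1 - \<epsilon> / 4) * (2 - \<epsilon> / 2)) * (L / q)"
        using Lq q_inv by (intro mult_right_mono) auto
      then show ?thesis by (simp only: mult.assoc)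
    qed
    also have "\<dots> \<le> (1 - \<epsilon> / 4) * \<kappa>" using \<epsilon> \<kappa>(1) by (intro mult_left_mono) auto
    also have "\<dots> = \<kappa> - t" by (simp add: t_def field_simps)
    finally show ?thesis using that by simp
  qed
  have "measure ?M {\<omega>\<in>space ?M. ?c \<omega> < \<kappa> - t} \<le>
      exp (- real n * r\<^sup>2 / 16) + exp (\<kappa> * sqrt (1 / p) ^ \<kappa> / s - t\<^sup>2 / \<kappa>)"
    by (rule prob_clique_number_less) (use r p \<kappa>0 tp t in auto)
  also have "\<dots> \<le> exp (- ln n / 16) + exp (- (\<epsilon>\<^sup>2 / 32 * ln n ^ 3))"
  proof (intro add_mono, unfold exp_le_cancel_iff)
    show "- real n * r\<^sup>2 / 16 \<le> - ln n / 16" using n by simp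
    have "\<kappa> * sqrt (1 / p) ^ \<kappa> / s = \<kappa> * (sqrt (1 / (1 - q)) ^ \<kappa> / s)" by (simp add: p(3))
    also have "\<dots> \<le> \<kappa> * (\<epsilon>\<^sup>2 / 32)" using tp(3) by (intro mult_left_mono) auto
    finally have "\<kappa> * sqrt (1 / p) ^ \<kappa> / s \<le> \<kappa> * (\<epsilon>\<^sup>2 / 32)" .
    moreover have "t\<^sup>2 / \<kappa> = \<kappa> * (\<epsilon>\<^sup>2 / 16)" using \<kappa>0 by (simp add: t_def power2_eq_square)
    ultimately have "\<kappa> * sqrt (1 / p) ^ \<kappa> / s - t\<^sup>2 / \<kappa> \<le>
        \<kappa> * (\<epsilon>\<^sup>2 / 32) - \<kappa> * (\<epsilon>\<^sup>2 / 16)" by linarith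
    also have "\<dots> = - (\<epsilon>\<^sup>2 / 32 * \<kappa>)" by simp
    also have "\<dots> \<le> - (\<epsilon>\<^sup>2 / 32 * ln n ^ 3)" using \<kappa>3 by (simp add: mult_left_mono)
    finally show "\<kappa> * sqrt (1 / p) ^ \<kappa> / s - t\<^sup>2 / \<kappa> \<le> - (\<epsilon>\<^sup>2 / 32 * ln n ^ 3)" .
  qed
  finally have low: "measure ?M {\<omega>\<in>space ?M. ?c \<omega> < \<kappa> - t} \<le> exp (- ln n / 16) + exp (- (\<epsilon>\<^sup>2 / 32 * ln n ^ 3))" .

  define Good where "Good = {\<omega>\<in>space ?M. (2 - \<epsilon>) * L / q \<le> ?c \<omega> \<and> ?c \<omega> \<le> 2 * L / q}"
  have sets: "Good \<in> sets ?M" "{\<omega>\<in>space ?M. k \<le> clique_number {..<n} (Gnrp_edges n r \<omega>)} \<in> sets ?M"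
    "{\<omega>\<in>space ?M. ?c \<omega> < \<kappa> - t} \<in> sets ?M"
    unfolding Good_def by (rule sets_Gnrp_edges)+
  have "1 - measure ?M Good = measure ?M (space ?M - Good)"
    using sets by (simp add: M.prob_compl)
  also have "\<dots> \<le> measure ?M ({\<omega>\<in>space ?M. k \<le> clique_number {..<n} (Gnrp_edges n r \<omega>)} \<union> {\<omega>\<in>space ?M. ?c \<omega> < \<kappa> - t})"
    using sets up_iff low_iff by (intro M.finite_measure_mono) (auto simp: Good_def)
  also have "\<dots> \<le> measure ?M {\<omega>\<in>space ?M. k \<le> clique_number {..<n} (Gnrp_edges n r \<omega>)} + measure ?M {\<omega>\<in>space ?M. ?c \<omega> < \<kappa> - t}"
    using sets by (intro measure_Un_le) auto
  finally show ?thesis using up low unfolding Good_def by linarith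
qed

text \<open>\<open>sqrt 2 / 2\<close> is the diameter of the unit torus: beyond it the graph no
  longer changes with \<open>r\<close>, while \<open>n * r^2\<close> keeps growing.\<close>

theorem theorem1:
  fixes \<epsilon> :: real
  assumes "\<epsilon> > 0"
  shows "\<exists>C>0. \<forall>r p :: nat \<Rightarrow> real.
    (\<forall>\<^sub>F n in sequentially.
        0 \<le> r n \<and> r n \<le> sqrt 2 / 2 \<and>
        real n * (r n)\<^sup>2 \<ge> ln (real n) \<and>
        C / (real n * (r n)\<^sup>2) \<le> 1 - p n \<and>
        1 - p n \<le> 1 / ln (real n) ^ 3) \<longrightarrow>
    (\<lambda>n. measure (Gnrp_space n (p n))
        {\<omega> \<in> space (Gnrp_space n (p n)).
          (2 - \<epsilon>) * ln ((1 - p n) * (real n * (r n)\<^sup>2)) / (1 - p n)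
            \<le> real (clique_number {..<n} (Gnrp_edges n (r n) \<omega>)) \<and>
          real (clique_number {..<n} (Gnrp_edges n (r n) \<omega>))
            \<le> 2 * ln ((1 - p n) * (real n * (r n)\<^sup>2)) / (1 - p n)})
      \<longlonglongrightarrow> 1"
proof -
  \<comment> \<open>The parameter bounds require \<epsilon> at most 1. The result for \<delta>
    implies that for \<epsilon>, as the lower bound only weakens when \<epsilon> grows.\<close>
  define \<delta> where "\<delta> = min \<epsilon> 1"
  have \<delta>: "0 < \<delta>" "\<delta> \<le> 1" "\<delta> \<le> \<epsilon>" using assms by (auto simp: \<delta>_def)
  obtain L0 where L0: "L0 \<ge> 72" and
    cond: "\<And>L. L \<ge> L0 \<Longrightarrow> 96 * L \<le> exp L \<and> 288 * L * exp (- (\<delta> * L / 8)) \<le> \<delta>\<^sup>2 / 32"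
    using large_L_conditions[OF \<delta>(1)] by blast
  show ?thesis
  \<comment> \<open>With \<open>C = exp L0\<close>, the hypothesis
    \<open>C / (n * r^2) \<le> 1 - p\<close> says exactly that \<open>L \<ge> L0\<close>.\<close>
  proof (intro exI[of _ "exp L0"] conjI allI impI)
    fix r p :: "nat \<Rightarrow> real"
    assume H: "\<forall>\<^sub>F n in sequentially. 0 \<le> r n \<and> r n \<le> sqrt 2 / 2 \<and>
        real n * (r n)\<^sup>2 \<ge> ln (real n) \<and> exp L0 / (real n * (r n)\<^sup>2) \<le> 1 - p n \<and>
        1 - p n \<le> 1 / ln (real n) ^ 3"
    define G where "G = (\<lambda>n \<eta>. {\<omega> \<in> space (Gnrp_space n (p n)).
          (2 - \<eta>) * ln ((1 - p n) * (real n * (r n)\<^sup>2)) / (1 - p n)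
            \<le> real (clique_number {..<n} (Gnrp_edges n (r n) \<omega>)) \<and>
          real (clique_number {..<n} (Gnrp_edges n (r n) \<omega>))
            \<le> 2 * ln ((1 - p n) * (real n * (r n)\<^sup>2)) / (1 - p n)})"
    have GM: "G n \<eta> \<in> sets (Gnrp_space n (p n))" for n \<eta>
      unfolding G_def by (rule sets_Gnrp_edges)
    define fail where "fail = (\<lambda>n::nat. 3 * n * exp (- (ln n ^ 3)) + (exp (- ln n / 16) + exp (- (\<delta>\<^sup>2 / 32 * ln n ^ 3))))"
    have "((\<lambda>n::nat. 1 / ln (real n) ^ 3) \<longlonglongrightarrow> 0)" by real_asymp
    then have small: "\<forall>\<^sub>F n::nat in sequentially. 1 / ln (real n) ^ 3 < \<delta> / 16"
      by (rule order_tendstoD) (use \<delta> in simp)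
    have pos: "\<forall>\<^sub>F n::nat in sequentially. ln (real n) > 0" by real_asymp
    have lower: "\<forall>\<^sub>F n in sequentially. 1 - fail n \<le> measure (Gnrp_space n (p n)) (G n \<epsilon>)"
      using H small pos
    proof eventually_elim
      case (elim n)
      define L where "L = ln ((1 - p n) * (real n * (r n)\<^sup>2))"
      interpret M: prob_space "Gnrp_space n (p n)" by (rule prob_space_Gnrp_space)
      have N: "real n * (r n)\<^sup>2 > 0" using elim by linarith
      have q: "exp L0 \<le> (1 - p n) * (real n * (r n)\<^sup>2)"
        using elim by (simp only: pos_divide_le_eq[OF N])
      then have "0 < (1 - p n) * (real n * (r n)\<^sup>2)" using exp_gt_zero[of L0] by linarith
      then have q0: "0 < 1 - p n" and L: "L \<ge> L0"
        using N q by (simp_all only: zero_less_mult_pos2 L_def ln_ge_iff)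
      have "sqrt 2 / 2 \<le> (1::real)" using real_sqrt_le_mono[of 2 4] by simp
      then have "r n \<le> 1" using elim by linarith
      moreover have "1 - p n \<le> \<delta> / 16" using elim by linarith
      ultimately have "1 - fail n \<le> measure (Gnrp_space n (p n)) (G n \<delta>)"
        using prob_clique_number_bounds[OF \<delta>(1,2) _ _ q0 _ _ _ _ L_def] elim L L0 cond[OF L]
        unfolding fail_def G_def L_def[symmetric] by simp
      also have "\<dots> \<le> measure (Gnrp_space n (p n)) (G n \<epsilon>)"
      proof (intro M.finite_measure_mono GM)
        have "(2 - \<epsilon>) * L / (1 - p n) \<le> (2 - \<delta>) * L / (1 - p n)"
          using \<delta> L L0 q0 by (intro divide_right_mono mult_right_mono) auto
        then show "G n \<delta> \<subseteq> G n \<epsilon>" unfolding G_def L_def[symmetric] by auto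
      qed
      finally show ?case .
    qed
    have upper: "\<forall>\<^sub>F n in sequentially. measure (Gnrp_space n (p n)) (G n \<epsilon>) \<le> 1"
      using prob_space.prob_le_1[OF prob_space_Gnrp_space] by simp
    have "(\<lambda>n. 1 - fail n) \<longlonglongrightarrow> 1 - 0"
      unfolding fail_def by (intro tendsto_diff tendsto_const failure_tendsto_0 \<delta>)
    then have "(\<lambda>n. measure (Gnrp_space n (p n)) (G n \<epsilon>)) \<longlonglongrightarrow> 1"
      by (intro tendsto_sandwich[OF lower upper]) simp_all
    then show "(\<lambda>n. measure (Gnrp_space n (p n))
        {\<omega> \<in> space (Gnrp_space n (p n)).
          (2 - \<epsilon>) * ln ((1 - p n) * (real n * (r n)\<^sup>2)) / (1 - p n)
            \<le> real (clique_number {..<n} (Gnrp_edges n (r n) \<omega>)) \<and>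
          real (clique_number {..<n} (Gnrp_edges n (r n) \<omega>))
            \<le> 2 * ln ((1 - p n) * (real n * (r n)\<^sup>2)) / (1 - p n)}) \<longlonglongrightarrow> 1"
      unfolding G_def .
  qed simp
qed

end
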